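(* Let $M^2$ be an orientable surface in $\mathbb{R}^n$ (endowed with an orientation and with the induced metric $g$), let $\mathbf{i}:M\to\mathbb{R}^n$ be the inclusion and let $G:M\to G(n,2)$ be its Gauss map. Then the following conditions are equivalent: (a) $S^G=0$; (b) $G$ is weakly conformal; (c) $M^2$ is pseudo-umbilical; (d) $S_2^{\mathbf{i}}=\frac12|\tau(\mathbf{i})|^2 g$.
   Context: All manifolds and maps are smooth. For a map $\phi:(M^m,g)\to(N,h)$ between Riemannian manifolds, $\nabla$ denotes the connection on $\phi^{-1}TN$ induced by the Levi-Civita connection of $N$ (and also induced connections on related bundles), $\nabla d\phi$ is the second fundamental form of $\phi$, and $\tau(\phi)=\operatorname{trace}_g\nabla d\phi$ is the tension field. With $\{e_i\}$ a local $g$-orthonormal frame, put $\langle d\phi,\nabla\tau(\phi)\rangle=\sum_i\langle d\phi(e_i),\nabla_{e_i}\tau(\phi)\rangle$. The biharmonic stress-energy tensor of $\phi$ is the symmetric $(0,2)$-tensor $$S_2^{\phi}(X,Y)=\Big(\tfrac12|\tau(\phi)|^2+\langle d\phi,\nabla\tau(\phi)\rangle\Big)g(X,Y)-\langle d\phi(X),\nabla_Y\tau(\phi)\rangle-\langle d\phi(Y),\nabla_X\tau(\phi)\rangle .$$ The (harmonic) stress-energy tensor of $\phi$ is $S^{\phi}=e(\phi)g-\phi^*h$, where $e(\phi)=\frac12|d\phi|^2=\frac12\operatorname{trace}_g\phi^*h$. For an oriented submanifold $M^m\subset\mathbb{R}^n$ with induced metric $g$, the Gauss map $G:M\to G(n,m)$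 sends $q$ to the oriented $m$-plane $T_qM$, i.e. $G(q)=X_1(q)\wedge\dots\wedge X_m(q)$ for a positively oriented orthonormal basis of $T_qM$; $G(n,m)$ is the Grassmannian of oriented $m$-planes of $\mathbb{R}^n$ with its canonical metric $g_{can}$: for a plane $P$ with orthonormal basis $X_1,\dots,X_m$ completed to an orthonormal basis $X_1,\dots,X_n$ of $\mathbb{R}^n$, identify $T_PG(n,m)$ with $P^*\otimes P^\perp$ and require $\{X_j^*\otimes X_a: 1\le j\le m<a\le n\}$ to be an orthonormal basis. $S^G$ is the stress-energy tensor of $G:(M,g)\to(G(n,m),g_{can})$. A map $\phi:(M,g)\to(N,h)$ is weakly conformal if $\phi^*h=\lambda g$ for some function $\lambda\ge0$ on $M$ (zeros allowed). Let $B$ be the second fundamental form of $M$ in $\mathbb{R}^n$ and $H=\frac1m\operatorname{trace}_g B$ the mean curvature vector field. $M$ is pseudo-umbilical if $\langle H,B(X,Y)\rangle=|H|^2g(X,Y)$ for all tangent $X,Y$ (so minimal submanifolds are included). *)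

theory Defs
  imports "HOL-Analysis.Analysis"
begin

section \<open>Embedded surfaces in Euclidean space\<close>

primrec k_smooth_on ::
  "nat \<Rightarrow> 'a::euclidean_space set \<Rightarrow> ('a \<Rightarrow> 'b::euclidean_space) \<Rightarrow> bool" where
  "k_smooth_on 0 S f \<longleftrightarrow> continuous_on S f"
| "k_smooth_on (Suc k) S f \<longleftrightarrow>
     (\<forall>x\<in>S. f differentiable at x) \<and>
     (\<forall>v. k_smooth_on k S (\<lambda>x. frechet_derivative f (at x) v))"

text \<open>Only used for open \<open>S\<close>.\<close>

definition smooth_on ::
  "'a::euclidean_space set \<Rightarrow> ('a \<Rightarrow> 'b::euclidean_space) \<Rightarrow> bool" where
  "smooth_on S f \<longleftrightarrow> (\<forall>k. k_smooth_on k S f)"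

definition parametrization ::
  "'a::euclidean_space set \<Rightarrow> (real^2) set \<Rightarrow> (real^2 \<Rightarrow> 'a) \<Rightarrow> bool" where
  "parametrization M U x \<longleftrightarrow>
     open U \<and> smooth_on U x \<and> openin (top_of_set M) (x ` U) \<and>
     (\<exists>y. homeomorphism U (x ` U) x y) \<and>
     (\<forall>u\<in>U. inj (frechet_derivative x (at u)))"

definition surface :: "'a::euclidean_space set \<Rightarrow> bool" where
  "surface M \<longleftrightarrow> (\<forall>p\<in>M. \<exists>U x. parametrization M U x \<and> p \<in> x ` U)"

definition tangent_space :: "'a::euclidean_space set \<Rightarrow> 'a \<Rightarrow> 'a set" where
  "tangent_space M p =
     {v. \<exists>\<gamma> e. e > 0 \<and> \<gamma> ` {-e<..<e} \<subseteq> M \<and> smooth_on {-e<..<e} \<gamma> \<and>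
           \<gamma> 0 = p \<and> (\<gamma> has_vector_derivative v) (at (0::real))}"

text \<open>An orientation is given by the sets \<open>Or p\<close> of positively oriented bases of the tangent
  spaces: locally, they are the bases having the same orientation as the coordinate frame of a
  parametrization.\<close>

definition orientation ::
  "'a::euclidean_space set \<Rightarrow> ('a \<Rightarrow> ('a \<times> 'a) set) \<Rightarrow> bool" where
  "orientation M Or \<longleftrightarrow>
     (\<forall>p\<in>M. \<exists>U x. parametrization M U x \<and> p \<in> x ` U \<and>
        (\<forall>u\<in>U. let x1 = frechet_derivative x (at u) (axis 1 1);
                   x2 = frechet_derivative x (at u) (axis 2 1)
         in Or (x u) =
              {(a *\<^sub>R x1 + b *\<^sub>R x2, c *\<^sub>R x1 + d *\<^sub>R x2) | a b c d. a * d - b * c > 0}))"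

definition smooth_map ::
  "'a::euclidean_space set \<Rightarrow> ('a \<Rightarrow> 'b::euclidean_space) \<Rightarrow> bool" where
  "smooth_map M \<phi> \<longleftrightarrow> (\<forall>U x. parametrization M U x \<longrightarrow> smooth_on U (\<phi> \<circ> x))"

text \<open>The differential at \<open>p \<in> M\<close> of a map defined on the surface \<open>M\<close>.  The derivative within \<open>M\<close>
  depends only on the restriction of \<open>\<phi>\<close> to \<open>M\<close>; as a linear map on the ambient space it is not
  unique, but its values on \<open>tangent_space M p\<close> are, and it is only ever applied to tangent
  vectors.  For vector-valued maps, i.e. sections of a pulled back tangent bundle of a Euclidean
  space, it is also the covariant derivative (the Levi-Civita connection of a Euclidean space being
  flat).\<close>

definition diff ::
  "'a::euclidean_space set \<Rightarrow> ('a \<Rightarrow> 'b::euclidean_space) \<Rightarrow> 'a \<Rightarrow> 'a \<Rightarrow> 'b" where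
  "diff M \<phi> p v = frechet_derivative \<phi> (at p within M) v"

definition vector_field :: "'a::euclidean_space set \<Rightarrow> ('a \<Rightarrow> 'a) \<Rightarrow> bool" where
  "vector_field M X \<longleftrightarrow> smooth_map M X \<and> (\<forall>p\<in>M. X p \<in> tangent_space M p)"

section \<open>The Levi-Civita connection of the induced metric\<close>

text \<open>The induced metric is the restriction of the inner product to the tangent spaces.  Torsion
  freeness is expressed by letting both sides of \<open>\<nabla>\<^sub>X Y - \<nabla>\<^sub>Y X = [X, Y]\<close> act on functions.\<close>

definition affine_connection ::
  "'a::euclidean_space set \<Rightarrow> (('a \<Rightarrow> 'a) \<Rightarrow> ('a \<Rightarrow> 'a) \<Rightarrow> 'a \<Rightarrow> 'a) \<Rightarrow> bool" where
  "affine_connection M D \<longleftrightarrow>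
     (\<forall>X Y. vector_field M X \<longrightarrow> vector_field M Y \<longrightarrow> vector_field M (D X Y)) \<and>
     (\<forall>X X' Y. vector_field M X \<longrightarrow> vector_field M X' \<longrightarrow> vector_field M Y \<longrightarrow>
        (\<forall>p\<in>M. D (\<lambda>q. X q + X' q) Y p = D X Y p + D X' Y p \<and>
                D Y (\<lambda>q. X q + X' q) p = D Y X p + D Y X' p)) \<and>
     (\<forall>(f::'a \<Rightarrow> real) X Y. smooth_map M f \<longrightarrow> vector_field M X \<longrightarrow> vector_field M Y \<longrightarrow>
        (\<forall>p\<in>M. D (\<lambda>q. f q *\<^sub>R X q) Y p = f p *\<^sub>R D X Y p \<and>
                D X (\<lambda>q. f q *\<^sub>R Y q) p = diff M f p (X p) *\<^sub>R Y p + f p *\<^sub>R D X Y p))"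

definition torsion_free ::
  "'a::euclidean_space set \<Rightarrow> (('a \<Rightarrow> 'a) \<Rightarrow> ('a \<Rightarrow> 'a) \<Rightarrow> 'a \<Rightarrow> 'a) \<Rightarrow> bool" where
  "torsion_free M D \<longleftrightarrow>
     (\<forall>X Y (f::'a \<Rightarrow> real). vector_field M X \<longrightarrow> vector_field M Y \<longrightarrow> smooth_map M f \<longrightarrow>
        (\<forall>p\<in>M. diff M f p (D X Y p - D Y X p) =
                  diff M (\<lambda>q. diff M f q (Y q)) p (X p) - diff M (\<lambda>q. diff M f q (X q)) p (Y p)))"

definition metric_connection ::
  "'a::euclidean_space set \<Rightarrow> (('a \<Rightarrow> 'a) \<Rightarrow> ('a \<Rightarrow> 'a) \<Rightarrow> 'a \<Rightarrow> 'a) \<Rightarrow> bool" where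
  "metric_connection M D \<longleftrightarrow>
     (\<forall>X Y Z. vector_field M X \<longrightarrow> vector_field M Y \<longrightarrow> vector_field M Z \<longrightarrow>
        (\<forall>p\<in>M. diff M (\<lambda>q. Y q \<bullet> Z q) p (X p) = D X Y p \<bullet> Z p + Y p \<bullet> D X Z p))"

text \<open>The values on \<open>M\<close> of the chosen connection, applied to vector fields, do not depend on the
  choice.\<close>

definition levi_civita ::
  "'a::euclidean_space set \<Rightarrow> ('a \<Rightarrow> 'a) \<Rightarrow> ('a \<Rightarrow> 'a) \<Rightarrow> 'a \<Rightarrow> 'a" where
  "levi_civita M = (SOME D. affine_connection M D \<and> torsion_free M D \<and> metric_connection M D)"

section \<open>Tension field and stress-energy tensors\<close>

text \<open>Tensors are pointwise objects here, to be evaluated at \<open>p \<in> M\<close> and at vectors of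
  \<open>tangent_space M p\<close>.\<close>

definition orthonormal_basis :: "'a::euclidean_space set \<Rightarrow> 'a set \<Rightarrow> bool" where
  "orthonormal_basis V E \<longleftrightarrow> pairwise orthogonal E \<and> (\<forall>e\<in>E. norm e = 1) \<and> span E = V"

definition trace_on ::
  "'a::euclidean_space set \<Rightarrow> ('a \<Rightarrow> 'a \<Rightarrow> 'b::real_vector) \<Rightarrow> 'b" where
  "trace_on V b = (let E = (SOME E. orthonormal_basis V E) in \<Sum>e\<in>E. b e e)"

text \<open>\<open>(\<nabla>d\<phi>)(X, Y) = \<nabla>\<^sub>X (d\<phi> Y) - d\<phi> (\<nabla>\<^sub>X Y)\<close> for a map \<open>\<phi>\<close> from \<open>M\<close> to a Euclidean space;
  being tensorial, it may be evaluated at \<open>p\<close> using any extensions of the given tangent vectors to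
  vector fields.\<close>

definition nabla_d ::
  "'a::euclidean_space set \<Rightarrow> ('a \<Rightarrow> 'b::euclidean_space) \<Rightarrow> 'a \<Rightarrow> 'a \<Rightarrow> 'a \<Rightarrow> 'b" where
  "nabla_d M \<phi> p u v =
     (THE w. \<exists>X Y. vector_field M X \<and> vector_field M Y \<and> X p = u \<and> Y p = v \<and>
        w = diff M (\<lambda>q. diff M \<phi> q (Y q)) p (X p) - diff M \<phi> p (levi_civita M X Y p))"

definition tension ::
  "'a::euclidean_space set \<Rightarrow> ('a \<Rightarrow> 'b::euclidean_space) \<Rightarrow> 'a \<Rightarrow> 'b" where
  "tension M \<phi> p = trace_on (tangent_space M p) (nabla_d M \<phi> p)"

definition biharmonic_stress_energy ::
  "'a::euclidean_space set \<Rightarrow> ('a \<Rightarrow> 'b::euclidean_space) \<Rightarrow> 'a \<Rightarrow> 'a \<Rightarrow> 'a \<Rightarrow> real" where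
  "biharmonic_stress_energy M \<phi> p u v =
     (let \<tau> = tension M \<phi> in
       ((norm (\<tau> p))\<^sup>2 / 2 +
         trace_on (tangent_space M p) (\<lambda>e e'. diff M \<phi> p e \<bullet> diff M \<tau> p e')) * (u \<bullet> v)
       - diff M \<phi> p u \<bullet> diff M \<tau> p v - diff M \<phi> p v \<bullet> diff M \<tau> p u)"

text \<open>For a map into a Riemannian manifold that is embedded in a Euclidean space, but whose metric
  \<open>h\<close> (at \<open>P\<close>, on tangent vectors \<open>\<xi>\<close>, \<open>\<eta>\<close>: \<open>h P \<xi> \<eta>\<close>) need not be the induced one.\<close>

definition pullback ::
  "'a::euclidean_space set \<Rightarrow> ('a \<Rightarrow> 'b::euclidean_space) \<Rightarrow> ('b \<Rightarrow> 'b \<Rightarrow> 'b \<Rightarrow> real) \<Rightarrow>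
   'a \<Rightarrow> 'a \<Rightarrow> 'a \<Rightarrow> real" where
  "pullback M \<phi> h p u v = h (\<phi> p) (diff M \<phi> p u) (diff M \<phi> p v)"

definition energy_density ::
  "'a::euclidean_space set \<Rightarrow> ('a \<Rightarrow> 'b::euclidean_space) \<Rightarrow> ('b \<Rightarrow> 'b \<Rightarrow> 'b \<Rightarrow> real) \<Rightarrow>
   'a \<Rightarrow> real" where
  "energy_density M \<phi> h p = trace_on (tangent_space M p) (pullback M \<phi> h p) / 2"

definition stress_energy ::
  "'a::euclidean_space set \<Rightarrow> ('a \<Rightarrow> 'b::euclidean_space) \<Rightarrow> ('b \<Rightarrow> 'b \<Rightarrow> 'b \<Rightarrow> real) \<Rightarrow>
   'a \<Rightarrow> 'a \<Rightarrow> 'a \<Rightarrow> real" where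
  "stress_energy M \<phi> h p u v = energy_density M \<phi> h p * (u \<bullet> v) - pullback M \<phi> h p u v"

definition weakly_conformal ::
  "'a::euclidean_space set \<Rightarrow> ('a \<Rightarrow> 'b::euclidean_space) \<Rightarrow> ('b \<Rightarrow> 'b \<Rightarrow> 'b \<Rightarrow> real) \<Rightarrow> bool" where
  "weakly_conformal M \<phi> h \<longleftrightarrow>
     (\<exists>l :: 'a \<Rightarrow> real. \<forall>p\<in>M. l p \<ge> 0 \<and>
        (\<forall>u\<in>tangent_space M p. \<forall>v\<in>tangent_space M p. pullback M \<phi> h p u v = l p * (u \<bullet> v)))"

section \<open>Second fundamental form\<close>

text \<open>The component normal to \<open>M\<close> of the ambient derivative of any vector field extending \<open>v\<close>.\<close>

definition second_fundamental_form ::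
  "'a::euclidean_space set \<Rightarrow> 'a \<Rightarrow> 'a \<Rightarrow> 'a \<Rightarrow> 'a" where
  "second_fundamental_form M p u v =
     (THE w. \<exists>Y. vector_field M Y \<and> Y p = v \<and>
        w \<in> (tangent_space M p)\<^sup>\<bottom> \<and> diff M Y p u - w \<in> tangent_space M p)"

definition mean_curvature :: "'a::euclidean_space set \<Rightarrow> 'a \<Rightarrow> 'a" where
  "mean_curvature M p =
     (1/2) *\<^sub>R trace_on (tangent_space M p) (second_fundamental_form M p)"

definition pseudo_umbilical :: "'a::euclidean_space set \<Rightarrow> bool" where
  "pseudo_umbilical M \<longleftrightarrow>
     (\<forall>p\<in>M. \<forall>u\<in>tangent_space M p. \<forall>v\<in>tangent_space M p.
        mean_curvature M p \<bullet> second_fundamental_form M p u v =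
          (norm (mean_curvature M p))\<^sup>2 * (u \<bullet> v))"

section \<open>The Grassmannian of oriented planes and the Gauss map\<close>

text \<open>Bivectors of \<open>\<real>\<^sup>n\<close> are represented by skew-symmetric matrices, and \<open>G(n,2)\<close> by its
  embedded copy \<open>{wedge x y | x y orthonormal}\<close>.\<close>

definition wedge :: "real^'n \<Rightarrow> real^'n \<Rightarrow> real^'n^'n" where
  "wedge x y = (\<chi> i j. x $ i * y $ j - x $ j * y $ i)"

text \<open>Canonical metric at the plane \<open>P = x \<and> y\<close>.  A curve \<open>X\<^sub>1(t) \<and> X\<^sub>2(t)\<close> in \<open>G(n,2)\<close> starting at
  \<open>x \<and> y\<close> with \<open>X\<^sub>i'(0)\<close> normal to \<open>P\<close> has velocity \<open>X\<^sub>1'(0) \<and> y + x \<and> X\<^sub>2'(0)\<close>, and corresponds to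
  \<open>x\<^sup>* \<otimes> X\<^sub>1'(0) + y\<^sup>* \<otimes> X\<^sub>2'(0)\<close> in \<open>P\<^sup>* \<otimes> P\<^sup>\<bottom>\<close>.  So for \<open>a\<close> in an orthonormal basis \<open>E\<close> of \<open>P\<^sup>\<bottom>\<close>,
  \<open>wedge a y\<close> and \<open>wedge x a\<close> stand for \<open>x\<^sup>* \<otimes> a\<close> and \<open>y\<^sup>* \<otimes> a\<close>, and these vectors are declared
  to be orthonormal.\<close>

definition grassmann_metric ::
  "real^'n^'n \<Rightarrow> real^'n^'n \<Rightarrow> real^'n^'n \<Rightarrow> real" where
  "grassmann_metric P \<xi> \<eta> =
     (THE r. \<exists>x y E c d c' d'.
        norm x = 1 \<and> norm y = 1 \<and> orthogonal x y \<and> P = wedge x y \<and>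
        orthonormal_basis ({x, y}\<^sup>\<bottom>) E \<and>
        \<xi> = (\<Sum>a\<in>E. c a *\<^sub>R wedge a y + d a *\<^sub>R wedge x a) \<and>
        \<eta> = (\<Sum>a\<in>E. c' a *\<^sub>R wedge a y + d' a *\<^sub>R wedge x a) \<and>
        r = (\<Sum>a\<in>E. c a * c' a + d a * d' a))"

definition gauss_map ::
  "(real^'n \<Rightarrow> ((real^'n) \<times> (real^'n)) set) \<Rightarrow> real^'n \<Rightarrow> real^'n^'n" where
  "gauss_map Or q =
     (THE P. \<exists>x y. (x, y) \<in> Or q \<and> norm x = 1 \<and> norm y = 1 \<and> orthogonal x y \<and> P = wedge x y)"

end

theory Submission
  imports Defs
begin

text \<open>
  Everything is expressed by the second fundamental form \<open>B\<close> of the surface.  In an orthonormal frame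
  \<open>e\<^sub>1\<close>, \<open>e\<^sub>2\<close> of a tangent plane, the Gauss map \<open>G = e\<^sub>1 \<and> e\<^sub>2\<close> has derivative
  \<open>dG(u) = B(u, e\<^sub>1) \<and> e\<^sub>2 + e\<^sub>1 \<and> B(u, e\<^sub>2)\<close> (\<open>diff_gauss_map\<close>), so the pullback of the canonical metric is
  \<open>P(u, v) = B(u, e\<^sub>1) \<bullet> B(v, e\<^sub>1) + B(u, e\<^sub>2) \<bullet> B(v, e\<^sub>2)\<close>.  With \<open>2 H = B\<^sub>1\<^sub>1 + B\<^sub>2\<^sub>2\<close> one reads off
  \<open>P\<^sub>1\<^sub>2 = 2 H \<bullet> B\<^sub>1\<^sub>2\<close> and \<open>P\<^sub>1\<^sub>1 - P\<^sub>2\<^sub>2 = 2 H \<bullet> (B\<^sub>1\<^sub>1 - B\<^sub>2\<^sub>2)\<close>: the trace-free part of \<open>P\<close> is twice that of the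
  form \<open>H \<bullet> B\<close>.  In dimension two the stress-energy tensor is minus the trace-free part of \<open>P\<close>.
  This gives the equivalence of (a), (b) and (c), at every single point (\<open>pointwise_equivalences\<close>).

  For (d), the tension field of the inclusion is \<open>\<tau> = 2 H\<close>.  It is normal, so by the Weingarten
  equation \<open>u \<bullet> d\<tau>(v) = - 2 H \<bullet> B(u, v)\<close>.  Hence the biharmonic stress-energy tensor is
  \<open>- 2 |H|\<^sup>2 g + 4 H \<bullet> B\<close> (\<open>biharmonic_stress_energy_id\<close>), and it equals \<open>|\<tau>|\<^sup>2 g / 2 = 2 |H|\<^sup>2 g\<close> if and
  only if \<open>H \<bullet> B = |H|\<^sup>2 g\<close>.

  Most of the work is to identify these tensors with the objects that define them.  The orthogonal
  projection \<open>tproj\<close> to the tangent spaces is the main tool: it depends smoothly on the point, extends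
  tangent vectors to global vector fields, yields the Levi-Civita connection as the projection of
  the ambient derivative, and turns traces over tangent planes into sums over a fixed basis of the
  ambient space.  Charts enter only for the inverse function argument that describes tangent spaces,
  for smoothness, for the Gauss map, and for the Lie bracket, whose tangency rests on the symmetry of
  second derivatives.
\<close>

section \<open>Calculus of smooth functions\<close>

lemma k_smooth_on_cong:
  assumes "open S" "k_smooth_on k S f" "\<And>x. x \<in> S \<Longrightarrow> f x = g x"
  shows "k_smooth_on k S g"
  using assms(2,3)
proof (induction k arbitrary: f g)
  case 0
  then show ?case using continuous_on_cong[of S S f g] by simp
next
  case (Suc k)
  have d: "(g has_derivative frechet_derivative f (at x)) (at x)" if "x \<in> S" for x
    using Suc.prems that \<open>open S\<close>
    by (auto intro: has_derivative_transform_within_open simp: frechet_derivative_works)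
  have "k_smooth_on k S (\<lambda>x. frechet_derivative g (at x) v)" for v
    by (rule Suc.IH[of "\<lambda>x. frechet_derivative f (at x) v"])
      (use Suc.prems frechet_derivative_at[OF d] in auto)
  then show ?case using d by (auto simp: differentiable_def)
qed

text \<open>The introduction rule behind every closure property below: it replaces \<open>frechet_derivative\<close>, whose
  value at compound functions has no usable equation, by whatever derivative the differentiation
  rules produce.\<close>

lemma k_smooth_on_SucI:
  assumes "open S" and D: "\<And>x. x \<in> S \<Longrightarrow> (f has_derivative D x) (at x)"
    and "\<And>v. k_smooth_on k S (\<lambda>x. D x v)"
  shows "k_smooth_on (Suc k) S f"
proof -
  have "k_smooth_on k S (\<lambda>x. frechet_derivative f (at x) v)" for v
    by (rule k_smooth_on_cong[OF assms(1,3)]) (simp add: frechet_derivative_at[OF D])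
  then show ?thesis using D by (auto simp: differentiable_def)
qed

lemma k_smooth_on_has_derivative:
  "k_smooth_on (Suc k) S f \<Longrightarrow> x \<in> S \<Longrightarrow> (f has_derivative frechet_derivative f (at x)) (at x)"
  by (simp add: frechet_derivative_works)

lemma k_smooth_on_SucD: "k_smooth_on (Suc k) S f \<Longrightarrow> k_smooth_on k S f"
proof (induction k arbitrary: f)
  case 0
  then show ?case
    by (auto intro!: continuous_at_imp_continuous_on differentiable_imp_continuous_within)
next
  case (Suc k)
  then show ?case by (simp del: k_smooth_on.simps add: k_smooth_on.simps(2)[of "Suc k"])
     (simp add: k_smooth_on.simps(2)[of k])
qed

lemma k_smooth_on_const: "open S \<Longrightarrow> k_smooth_on k S (\<lambda>x. c)"
  by (induction k arbitrary: c) auto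

lemma k_smooth_on_add:
  assumes "open S"
  shows "k_smooth_on k S f \<Longrightarrow> k_smooth_on k S g \<Longrightarrow> k_smooth_on k S (\<lambda>x. f x + g x)"
proof (induction k arbitrary: f g)
  case 0
  then show ?case by (simp add: continuous_on_add)
next
  case (Suc k)
  show ?case
    by (rule k_smooth_on_SucI[OF assms(1) has_derivative_add[OF k_smooth_on_has_derivative
          k_smooth_on_has_derivative]]) (use assms Suc in auto)
qed

lemma k_smooth_on_bilinear:
  assumes h: "bounded_bilinear h" and "open S"
  shows "k_smooth_on k S f \<Longrightarrow> k_smooth_on k S g \<Longrightarrow> k_smooth_on k S (\<lambda>x. h (f x) (g x))"
proof (induction k arbitrary: f g)
  case 0
  then show ?case by (simp add: bounded_bilinear.continuous_on[OF h])
next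
  case (Suc k)
  have "k_smooth_on k S f" "k_smooth_on k S g"
    using Suc.prems k_smooth_on_SucD by blast+
  then show ?case
    by (intro k_smooth_on_SucI[OF assms(2) bounded_bilinear.FDERIV[OF h k_smooth_on_has_derivative
          k_smooth_on_has_derivative]] k_smooth_on_add) (use assms Suc in auto)
qed

lemma k_smooth_on_inverse:
  fixes f :: "'a::euclidean_space \<Rightarrow> real"
  assumes "open S" and nz: "\<And>x. x \<in> S \<Longrightarrow> f x \<noteq> 0"
  shows "k_smooth_on k S f \<Longrightarrow> k_smooth_on k S (\<lambda>x. inverse (f x))"
proof (induction k)
  case 0
  then show ?case using nz by (simp add: continuous_on_inverse)
next
  case (Suc k)
  have 1: "((\<lambda>x. inverse (f x)) has_derivative
      (\<lambda>v. (- 1) * (inverse (f x) * (frechet_derivative f (at x) v * inverse (f x))))) (at x)" if "x \<in> S" for x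
    using Deriv.has_derivative_inverse[OF nz[OF that] k_smooth_on_has_derivative[OF Suc.prems that]]
    by (simp add: mult.assoc)
  have "k_smooth_on k S f" using Suc.prems k_smooth_on_SucD by blast
  then have "k_smooth_on k S (\<lambda>x. inverse (f x))" by (rule Suc.IH)
  then show ?case
    by (intro k_smooth_on_SucI[OF assms(1) 1] k_smooth_on_bilinear[OF bounded_bilinear_mult]
       k_smooth_on_const) (use assms Suc in auto)
qed

lemma k_smooth_on_affine_line:
  fixes f :: "'a::euclidean_space \<Rightarrow> 'b::euclidean_space"
  assumes "open I" and "\<And>t. t \<in> I \<Longrightarrow> u + t *\<^sub>R a \<in> U"
  shows "k_smooth_on k U f \<Longrightarrow> k_smooth_on k I (\<lambda>t::real. f (u + t *\<^sub>R a))"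
proof (induction k arbitrary: f)
  case 0
  then show ?case
    using assms by (auto intro!: continuous_on_compose2[of U f] continuous_intros)
next
  case (Suc k)
  have 1: "((\<lambda>t. f (u + t *\<^sub>R a)) has_derivative
      (\<lambda>s. s *\<^sub>R frechet_derivative f (at (u + t *\<^sub>R a)) a)) (at t)" if "t \<in> I" for t
  proof -
    have f: "(f has_derivative frechet_derivative f (at (u + t *\<^sub>R a))) (at (u + t *\<^sub>R a))"
      using Suc.prems assms that k_smooth_on_has_derivative by blast
    have "((\<lambda>t. u + t *\<^sub>R a) has_derivative (\<lambda>s. s *\<^sub>R a)) (at t)"
      by (auto intro!: derivative_eq_intros)
    from has_derivative_compose[OF this f]
    show ?thesis
      by (simp add: linear_scale[OF has_derivative_linear[OF f]])
  qed
  have "k_smooth_on k I (\<lambda>t. frechet_derivative f (at (u + t *\<^sub>R a)) a)"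
    by (rule Suc.IH[of "\<lambda>x. frechet_derivative f (at x) a"]) (use Suc.prems in simp)
  then show ?case
    by (intro k_smooth_on_SucI[OF assms(1) 1] k_smooth_on_bilinear[OF bounded_bilinear_scaleR]
       k_smooth_on_const assms(1))
qed

named_theorems smooth_intros

lemma smooth_on_cong:
  "open S \<Longrightarrow> smooth_on S f \<Longrightarrow> (\<And>x. x \<in> S \<Longrightarrow> f x = g x) \<Longrightarrow> smooth_on S g"
  unfolding smooth_on_def using k_smooth_on_cong by blast

lemma smooth_on_const [smooth_intros]: "open S \<Longrightarrow> smooth_on S (\<lambda>x. c)"
  by (simp add: smooth_on_def k_smooth_on_const)

lemma smooth_on_add [smooth_intros]:
  "open S \<Longrightarrow> smooth_on S f \<Longrightarrow> smooth_on S g \<Longrightarrow> smooth_on S (\<lambda>x. f x + g x)"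
  by (simp add: smooth_on_def k_smooth_on_add)

lemma smooth_on_scaleR [smooth_intros]:
  "open S \<Longrightarrow> smooth_on S f \<Longrightarrow> smooth_on S g \<Longrightarrow> smooth_on S (\<lambda>x. f x *\<^sub>R g x)"
  by (simp add: smooth_on_def k_smooth_on_bilinear[OF bounded_bilinear_scaleR])

lemma smooth_on_mult [smooth_intros]:
  fixes f :: "'a::euclidean_space \<Rightarrow> real"
  shows "open S \<Longrightarrow> smooth_on S f \<Longrightarrow> smooth_on S g \<Longrightarrow> smooth_on S (\<lambda>x. f x * g x)"
  by (simp add: smooth_on_def k_smooth_on_bilinear[OF bounded_bilinear_mult])

lemma smooth_on_inner [smooth_intros]:
  "open S \<Longrightarrow> smooth_on S f \<Longrightarrow> smooth_on S g \<Longrightarrow> smooth_on S (\<lambda>x. f x \<bullet> g x)"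
  by (simp add: smooth_on_def k_smooth_on_bilinear[OF bounded_bilinear_inner])

lemma smooth_on_diff [smooth_intros]:
  assumes "open S" "smooth_on S f" "smooth_on S g"
  shows "smooth_on S (\<lambda>x. f x - g x)"
proof -
  have "smooth_on S (\<lambda>x. f x + (- 1) *\<^sub>R g x)"
    using assms by (intro smooth_intros)
  then show ?thesis by simp
qed

lemma smooth_on_sum [smooth_intros]:
  "open S \<Longrightarrow> (\<And>i. i \<in> A \<Longrightarrow> smooth_on S (f i)) \<Longrightarrow> smooth_on S (\<lambda>x. \<Sum>i\<in>A. f i x)"
  by (induction A rule: infinite_finite_induct) (auto intro: smooth_intros)

lemma smooth_on_divide [smooth_intros]:
  fixes f :: "'a::euclidean_space \<Rightarrow> real"
  shows "open S \<Longrightarrow> smooth_on S f \<Longrightarrow> smooth_on S g \<Longrightarrow> (\<And>x. x \<in> S \<Longrightarrow> g x \<noteq> 0) \<Longrightarrow>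
    smooth_on S (\<lambda>x. f x / g x)"
  unfolding divide_inverse
  by (rule smooth_on_mult) (simp_all add: smooth_on_def k_smooth_on_inverse)

lemma smooth_on_has_derivative:
  "smooth_on S f \<Longrightarrow> x \<in> S \<Longrightarrow> (f has_derivative frechet_derivative f (at x)) (at x)"
  unfolding smooth_on_def using k_smooth_on_has_derivative by blast

lemma smooth_on_linear_derivative:
  "smooth_on S f \<Longrightarrow> x \<in> S \<Longrightarrow> linear (frechet_derivative f (at x))"
  using smooth_on_has_derivative has_derivative_linear by blast

lemma smooth_on_directional_derivative [smooth_intros]:
  "smooth_on S f \<Longrightarrow> smooth_on S (\<lambda>x. frechet_derivative f (at x) v)"
  unfolding smooth_on_def by (metis k_smooth_on.simps(2))

lemma smooth_on_imp_continuous_on: "smooth_on S f \<Longrightarrow> continuous_on S f"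
  unfolding smooth_on_def by (metis k_smooth_on.simps(1))

lemma smooth_on_affine_line:
  assumes "smooth_on U f" "open I" and "\<And>t. t \<in> I \<Longrightarrow> u + t *\<^sub>R a \<in> U"
  shows "smooth_on I (\<lambda>t::real. f (u + t *\<^sub>R a))"
  using assms k_smooth_on_affine_line unfolding smooth_on_def by blast

text \<open>The mean value theorem, applied first in the direction \<open>a\<close> to the increment of \<open>F\<close> in the direction
  \<open>b\<close>, and then in the direction \<open>b\<close>.\<close>

lemma second_difference_mean_value:
  fixes F :: "'a::euclidean_space \<Rightarrow> real"
  assumes F: "smooth_on U F" and "t > 0"
    and U: "\<And>s r. 0 \<le> s \<Longrightarrow> s \<le> t \<Longrightarrow> 0 \<le> r \<Longrightarrow> r \<le> t \<Longrightarrow> u + s *\<^sub>R a + r *\<^sub>R b \<in> U"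
  shows "\<exists>s r. 0 < s \<and> s < t \<and> 0 < r \<and> r < t \<and>
    F (u + t *\<^sub>R a + t *\<^sub>R b) - F (u + t *\<^sub>R a) - F (u + t *\<^sub>R b) + F u =
    t * t * frechet_derivative (\<lambda>w. frechet_derivative F (at w) a) (at (u + s *\<^sub>R a + r *\<^sub>R b)) b"
proof -
  have line: "((\<lambda>s. f (p + s *\<^sub>R d)) has_real_derivative frechet_derivative f (at (p + s *\<^sub>R d)) d) (at s)"
    if f: "smooth_on U f" and "p + s *\<^sub>R d \<in> U" for f :: "'a \<Rightarrow> real" and p d s
  proof -
    note D = smooth_on_has_derivative[OF that]
    have "((\<lambda>s. p + s *\<^sub>R d) has_derivative (\<lambda>s. s *\<^sub>R d)) (at s)"
      by (auto intro!: derivative_eq_intros)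
    from has_derivative_compose[OF this D]
    show ?thesis
      by (simp add: linear_scale[OF has_derivative_linear[OF D]] has_field_derivative_def mult_commute_abs)
  qed
  define g where "g s = F ((u + t *\<^sub>R b) + s *\<^sub>R a) - F (u + s *\<^sub>R a)" for s
  define Fa where "Fa w = frechet_derivative F (at w) a" for w
  have Fa: "smooth_on U Fa"
    unfolding Fa_def using F by (rule smooth_on_directional_derivative)
  have in1: "u + s *\<^sub>R a \<in> U" if "0 \<le> s" "s \<le> t" for s
    using U[of s 0] that \<open>t > 0\<close> by simp
  have in2: "(u + t *\<^sub>R b) + s *\<^sub>R a \<in> U" if "0 \<le> s" "s \<le> t" for s
    using U[of s t] that \<open>t > 0\<close> by (simp add: algebra_simps)
  have "(g has_real_derivative Fa ((u + t *\<^sub>R b) + s *\<^sub>R a) - Fa (u + s *\<^sub>R a)) (at s)"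
    if "0 \<le> s" "s \<le> t" for s
    unfolding g_def Fa_def
    by (rule DERIV_diff[OF line[OF F in2[OF that]] line[OF F in1[OF that]]])
  from MVT2[OF \<open>t > 0\<close> this] obtain s where s: "0 < s" "s < t"
    and gs: "g t - g 0 = t * (Fa ((u + t *\<^sub>R b) + s *\<^sub>R a) - Fa (u + s *\<^sub>R a))"
    by auto
  have "((\<lambda>r. Fa ((u + s *\<^sub>R a) + r *\<^sub>R b)) has_real_derivative
      frechet_derivative Fa (at ((u + s *\<^sub>R a) + r *\<^sub>R b)) b) (at r)" if "0 \<le> r" "r \<le> t" for r
    using line[OF Fa U[of s r]] s that by auto
  from MVT2[OF \<open>t > 0\<close> this] obtain r where r: "0 < r" "r < t"
    and "Fa ((u + s *\<^sub>R a) + t *\<^sub>R b) - Fa (u + s *\<^sub>R a) =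
      t * frechet_derivative Fa (at ((u + s *\<^sub>R a) + r *\<^sub>R b)) b"
    by auto
  with gs have "g t - g 0 = t * t * frechet_derivative Fa (at ((u + s *\<^sub>R a) + r *\<^sub>R b)) b"
    by (simp add: algebra_simps)
  then show ?thesis
    using s r unfolding g_def Fa_def[abs_def]
    by (intro exI[of _ s] exI[of _ r]) (simp add: algebra_simps)
qed

text \<open>The second difference of \<open>F\<close> over a parallelogram spanned by \<open>t a\<close> and \<open>t b\<close> is symmetric in \<open>a\<close> and
  \<open>b\<close>.  By the previous lemma it is, up to the factor \<open>t\<^sup>2\<close>, a value of either mixed derivative near
  \<open>u\<close>, and both are continuous at \<open>u\<close>.\<close>

lemma mixed_partial_derivatives_commute:
  fixes F :: "'a::euclidean_space \<Rightarrow> real"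
  assumes F: "smooth_on U F" and "open U" "u \<in> U"
  shows "frechet_derivative (\<lambda>w. frechet_derivative F (at w) a) (at u) b =
         frechet_derivative (\<lambda>w. frechet_derivative F (at w) b) (at u) a"
proof -
  define P where "P = (\<lambda>w. frechet_derivative (\<lambda>w. frechet_derivative F (at w) a) (at w) b)"
  define Q where "Q = (\<lambda>w. frechet_derivative (\<lambda>w. frechet_derivative F (at w) b) (at w) a)"
  have "continuous_on U P" "continuous_on U Q"
    unfolding P_def Q_def using F by (intro smooth_on_imp_continuous_on smooth_intros; assumption)+
  then have P: "isCont P u" and Q: "isCont Q u"
    using assms by (auto simp: continuous_on_eq_continuous_at)
  have "\<bar>P u - Q u\<bar> \<le> e" if "e > 0" for e
  proof -
    from P Q \<open>e > 0\<close> obtain d1 d2 where "d1 > 0" "d2 > 0"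
      and d1: "\<And>w. dist w u < d1 \<Longrightarrow> dist (P w) (P u) < e / 2"
      and d2: "\<And>w. dist w u < d2 \<Longrightarrow> dist (Q w) (Q u) < e / 2"
      unfolding continuous_at_eps_delta by (metis half_gt_zero)
    obtain d3 where "d3 > 0" and d3: "ball u d3 \<subseteq> U"
      using assms open_contains_ball by blast
    define d where "d = min d1 (min d2 d3)"
    have "d > 0" using \<open>d1 > 0\<close> \<open>d2 > 0\<close> \<open>d3 > 0\<close> by (simp add: d_def)
    \<comment> \<open>small enough for the whole parallelogram to lie within distance \<open>d\<close> of \<open>u\<close>\<close>
    define t where "t = d / (2 * (norm a + norm b + 1))"
    have n0: "norm a + norm b + 1 > 0"
      using norm_ge_zero[of a] norm_ge_zero[of b] by linarith
    have "t > 0" using \<open>d > 0\<close> n0 by (simp add: t_def)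
    have near: "dist (u + s *\<^sub>R a + r *\<^sub>R b) u < d" if "0 \<le> s" "s \<le> t" "0 \<le> r" "r \<le> t" for s r
    proof -
      have "dist (u + s *\<^sub>R a + r *\<^sub>R b) u \<le> s * norm a + r * norm b"
        using norm_triangle_ineq[of "s *\<^sub>R a" "r *\<^sub>R b"] that by (simp add: dist_norm)
      also have "\<dots> \<le> t * norm a + t * norm b"
        using that by (intro add_mono mult_right_mono) auto
      also have "\<dots> < t * (2 * (norm a + norm b + 1))"
        using \<open>t > 0\<close> by (simp add: algebra_simps add_nonneg_pos)
      also have "\<dots> = d" using n0 by (simp add: t_def)
      finally show ?thesis .
    qed
    have inU: "u + s *\<^sub>R a + r *\<^sub>R b \<in> U" if "0 \<le> s" "s \<le> t" "0 \<le> r" "r \<le> t" for s r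
      using near[OF that] d3 by (auto simp: d_def dist_commute)
    have inU': "u + s *\<^sub>R b + r *\<^sub>R a \<in> U" if "0 \<le> s" "s \<le> t" "0 \<le> r" "r \<le> t" for s r
      using inU[of r s] that by (simp add: algebra_simps)
    obtain s r where sr: "0 < s" "s < t" "0 < r" "r < t"
      and 1: "F (u + t *\<^sub>R a + t *\<^sub>R b) - F (u + t *\<^sub>R a) - F (u + t *\<^sub>R b) + F u =
        t * t * P (u + s *\<^sub>R a + r *\<^sub>R b)"
      using second_difference_mean_value[OF F \<open>t > 0\<close> inU] unfolding P_def by blast
    obtain s' r' where sr': "0 < s'" "s' < t" "0 < r'" "r' < t"
      and 2: "F (u + t *\<^sub>R b + t *\<^sub>R a) - F (u + t *\<^sub>R b) - F (u + t *\<^sub>R a) + F u =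
        t * t * Q (u + s' *\<^sub>R b + r' *\<^sub>R a)"
      using second_difference_mean_value[OF F \<open>t > 0\<close> inU'] unfolding Q_def by blast
    have "t * t * P (u + s *\<^sub>R a + r *\<^sub>R b) = t * t * Q (u + s' *\<^sub>R b + r' *\<^sub>R a)"
      using 1 2 by (simp add: algebra_simps)
    then have "P (u + s *\<^sub>R a + r *\<^sub>R b) = Q (u + r' *\<^sub>R a + s' *\<^sub>R b)"
      using \<open>t > 0\<close> by (simp add: algebra_simps)
    moreover have "dist (P (u + s *\<^sub>R a + r *\<^sub>R b)) (P u) < e / 2"
      using near[of s r] sr by (intro d1) (auto simp: d_def)
    moreover have "dist (Q (u + r' *\<^sub>R a + s' *\<^sub>R b)) (Q u) < e / 2"
      using near[of r' s'] sr' by (intro d2) (auto simp: d_def)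
    ultimately show ?thesis unfolding dist_real_def by linarith
  qed
  then have "\<bar>P u - Q u\<bar> \<le> 0"
    using dense_ge_bounded[of 0 1] by (metis field_le_epsilon add_0)
  then show ?thesis by (simp add: P_def Q_def)
qed

section \<open>Orthogonal projections and traces\<close>

definition proj :: "'a::euclidean_space set \<Rightarrow> 'a \<Rightarrow> 'a" where
  "proj V w = (THE t. t \<in> V \<and> (\<forall>s\<in>V. (w - t) \<bullet> s = 0))"

lemma proj_eqI:
  assumes "subspace V" "t \<in> V" "\<And>s. s \<in> V \<Longrightarrow> (w - t) \<bullet> s = 0"
  shows "proj V w = t"
  unfolding proj_def
proof (rule the_equality)
  fix t' assume t': "t' \<in> V \<and> (\<forall>s\<in>V. (w - t') \<bullet> s = 0)"
  then have "t - t' \<in> V" using assms by (simp add: subspace_diff)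
  then have "(w - t') \<bullet> (t - t') = 0" "(w - t) \<bullet> (t - t') = 0" using t' assms by auto
  then have "(t - t') \<bullet> (t - t') = 0" by (simp add: algebra_simps inner_commute)
  then show "t' = t" by simp
qed (use assms in auto)

lemma proj_in: "subspace V \<Longrightarrow> proj V w \<in> V"
  and proj_orthogonal: "subspace V \<Longrightarrow> s \<in> V \<Longrightarrow> (w - proj V w) \<bullet> s = 0"
proof -
  have *: "\<exists>t. t \<in> V \<and> (\<forall>s\<in>V. (w - t) \<bullet> s = 0)" if V: "subspace V"
  proof -
    obtain y z where "y \<in> span V" "\<And>w. w \<in> span V \<Longrightarrow> orthogonal z w" "w = y + z"
      using orthogonal_subspace_decomp_exists[of V w] by metis
    moreover have "span V = V" using V by (simp add: span_eq_iff)
    ultimately show ?thesis by (intro exI[of _ y]) (auto simp: orthogonal_def)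
  qed
  show "subspace V \<Longrightarrow> proj V w \<in> V" and "subspace V \<Longrightarrow> s \<in> V \<Longrightarrow> (w - proj V w) \<bullet> s = 0"
    using * proj_eqI by metis+
qed

lemma proj_id: "subspace V \<Longrightarrow> w \<in> V \<Longrightarrow> proj V w = w"
  by (rule proj_eqI) auto

lemma proj_inner:
  assumes "subspace V" "s \<in> V"
  shows "proj V w \<bullet> s = w \<bullet> s" "s \<bullet> proj V w = s \<bullet> w"
  using proj_orthogonal[OF assms, of w] by (simp_all add: inner_diff_left inner_commute[of s])

lemma linear_proj: "subspace V \<Longrightarrow> linear (proj V)"
  by (rule linearI; rule proj_eqI)
    (auto simp: proj_in subspace_add subspace_mul inner_simps proj_inner algebra_simps)

lemma orthonormal_basis_facts:
  assumes "orthonormal_basis V E"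
  shows "finite E" "E \<subseteq> V" "subspace V"
    and "e \<in> E \<Longrightarrow> f \<in> E \<Longrightarrow> e \<bullet> f = (if e = f then 1 else 0)"
proof -
  have E: "pairwise orthogonal E" "\<And>e. e \<in> E \<Longrightarrow> norm e = 1" "span E = V"
    using assms by (auto simp: orthonormal_basis_def)
  then have "independent E" using pairwise_orthogonal_independent[of E] by force
  then show "finite E" using independent_bound by blast
  show "E \<subseteq> V" using E(3) span_superset by blast
  show "subspace V" using E(3) by auto
  show "e \<in> E \<Longrightarrow> f \<in> E \<Longrightarrow> e \<bullet> f = (if e = f then 1 else 0)"
    using E(1,2) by (auto simp: pairwise_def orthogonal_def norm_eq_1)
qed

lemma orthonormal_basis_exists: "subspace V \<Longrightarrow> \<exists>E. orthonormal_basis V E"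
  using orthonormal_basis_subspace[of V] unfolding orthonormal_basis_def by metis

lemma proj_orthonormal_basis:
  assumes E: "orthonormal_basis V E"
  shows "proj V w = (\<Sum>e\<in>E. (w \<bullet> e) *\<^sub>R e)"
proof (rule proj_eqI)
  note facts = orthonormal_basis_facts[OF E]
  show "subspace V" by (rule facts)
  show "(\<Sum>e\<in>E. (w \<bullet> e) *\<^sub>R e) \<in> V"
    using facts by (auto intro!: subspace_sum subspace_mul)
  fix s assume "s \<in> V"
  then have "s \<in> span E" using E by (simp add: orthonormal_basis_def)
  then show "(w - (\<Sum>e\<in>E. (w \<bullet> e) *\<^sub>R e)) \<bullet> s = 0"
  proof (induction rule: span_induct_alt)
    case base
    then show ?case by simp
  next
    case (step c x y)
    have "(\<Sum>e\<in>E. (w \<bullet> e) * (e \<bullet> x)) = (\<Sum>e\<in>E. if e = x then w \<bullet> x else 0)"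
      using step facts by (intro sum.cong) auto
    then have "(w - (\<Sum>e\<in>E. (w \<bullet> e) *\<^sub>R e)) \<bullet> x = 0"
      using step facts by (simp add: inner_diff_left inner_sum_left)
    then show ?case using step by (simp add: inner_add_right)
  qed
qed

text \<open>Relative to \<open>V\<close>, because the tensors below are prescribed only on tangent vectors.\<close>

definition bilinear_on :: "'a::euclidean_space set \<Rightarrow> ('a \<Rightarrow> 'a \<Rightarrow> 'b::real_vector) \<Rightarrow> bool" where
  "bilinear_on V b \<longleftrightarrow>
     (\<forall>u\<in>V. \<forall>v\<in>V. \<forall>w\<in>V. b (u + v) w = b u w + b v w \<and> b w (u + v) = b w u + b w v) \<and>
     (\<forall>c. \<forall>u\<in>V. \<forall>v\<in>V. b (c *\<^sub>R u) v = c *\<^sub>R b u v \<and> b u (c *\<^sub>R v) = c *\<^sub>R b u v)"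

lemma bilinear_on_sum:
  assumes b: "bilinear_on V b" and V: "subspace V" and "finite E" "E \<subseteq> V" "w \<in> V"
  shows "b (\<Sum>e\<in>E. f e *\<^sub>R e) w = (\<Sum>e\<in>E. f e *\<^sub>R b e w)"
    and "b w (\<Sum>e\<in>E. f e *\<^sub>R e) = (\<Sum>e\<in>E. f e *\<^sub>R b w e)"
proof -
  have "b (0 *\<^sub>R w) w = 0 *\<^sub>R b w w" "b w (0 *\<^sub>R w) = 0 *\<^sub>R b w w"
    using b \<open>w \<in> V\<close> unfolding bilinear_on_def by blast+
  then have z: "b 0 w = 0" "b w 0 = 0" by auto
  have in_V: "(\<Sum>e\<in>A. f e *\<^sub>R e) \<in> V" if "A \<subseteq> V" for A
    using V that by (auto intro!: subspace_sum subspace_mul)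
  show "b (\<Sum>e\<in>E. f e *\<^sub>R e) w = (\<Sum>e\<in>E. f e *\<^sub>R b e w)"
    using \<open>finite E\<close> \<open>E \<subseteq> V\<close>
    by (induction E) (use b V \<open>w \<in> V\<close> z in_V in \<open>auto simp: bilinear_on_def subspace_mul\<close>)
  show "b w (\<Sum>e\<in>E. f e *\<^sub>R e) = (\<Sum>e\<in>E. f e *\<^sub>R b w e)"
    using \<open>finite E\<close> \<open>E \<subseteq> V\<close>
    by (induction E) (use b V \<open>w \<in> V\<close> z in_V in \<open>auto simp: bilinear_on_def subspace_mul\<close>)
qed

text \<open>Expanding the projections of the standard basis vectors in \<open>E\<close> turns the right hand side, which does
  not mention \<open>E\<close>, into the left hand side.  This gives the independence of the trace from the chosen
  basis, and a formula in which only the projection depends on \<open>V\<close>: a trace over the tangent spaces of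
  a surface becomes a manifestly smooth function of the point.\<close>

lemma trace_orthonormal_basis:
  assumes E: "orthonormal_basis V E" and b: "bilinear_on V b"
  shows "(\<Sum>e\<in>E. b e e) = (\<Sum>i\<in>Basis. b (proj V i) (proj V i))"
proof -
  note facts = orthonormal_basis_facts[OF E]
  have "b (proj V i) (proj V i) = (\<Sum>e\<in>E. \<Sum>f\<in>E. ((i \<bullet> e) * (i \<bullet> f)) *\<^sub>R b e f)" for i
  proof -
    have "b (proj V i) (proj V i) = (\<Sum>e\<in>E. (i \<bullet> e) *\<^sub>R b e (proj V i))"
      by (subst proj_orthonormal_basis[OF E]) (simp add: bilinear_on_sum[OF b] facts proj_in)
    also have "\<dots> = (\<Sum>e\<in>E. (i \<bullet> e) *\<^sub>R (\<Sum>f\<in>E. (i \<bullet> f) *\<^sub>R b e f))"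
      using facts(2)
      by (intro sum.cong refl arg_cong[where f = "scaleR _"])
        (auto simp: proj_orthonormal_basis[OF E] bilinear_on_sum(2)[OF b facts(3,1,2)])
    finally show ?thesis by (simp add: scaleR_sum_right)
  qed
  then have "(\<Sum>i\<in>Basis. b (proj V i) (proj V i)) =
      (\<Sum>i\<in>Basis. \<Sum>e\<in>E. \<Sum>f\<in>E. ((i \<bullet> e) * (i \<bullet> f)) *\<^sub>R b e f)"
    by simp
  also have "\<dots> = (\<Sum>e\<in>E. \<Sum>f\<in>E. \<Sum>i\<in>Basis. ((i \<bullet> e) * (i \<bullet> f)) *\<^sub>R b e f)"
    by (subst sum.swap, rule sum.cong[OF refl], subst sum.swap, rule refl)
  also have "\<dots> = (\<Sum>e\<in>E. \<Sum>f\<in>E. (e \<bullet> f) *\<^sub>R b e f)"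
  proof (intro sum.cong refl)
    fix e f :: 'a
    have "(\<Sum>i\<in>Basis. ((i \<bullet> e) * (i \<bullet> f)) *\<^sub>R b e f) = (\<Sum>i\<in>Basis. (e \<bullet> i) * (f \<bullet> i)) *\<^sub>R b e f"
      by (simp add: scaleR_sum_left inner_commute)
    then show "(\<Sum>i\<in>Basis. ((i \<bullet> e) * (i \<bullet> f)) *\<^sub>R b e f) = (e \<bullet> f) *\<^sub>R b e f"
      by (simp only: euclidean_inner[of e f])
  qed
  also have "\<dots> = (\<Sum>e\<in>E. \<Sum>f\<in>E. if e = f then b e e else 0)"
    by (intro sum.cong refl) (use facts in auto)
  also have "\<dots> = (\<Sum>e\<in>E. b e e)"
    using facts by simp
  finally show ?thesis by simp
qed

lemma trace_on_eq:
  assumes "subspace V" and b: "bilinear_on V b"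
  shows "trace_on V b = (\<Sum>i\<in>Basis. b (proj V i) (proj V i))"
proof -
  have "orthonormal_basis V (SOME E. orthonormal_basis V E)"
    using orthonormal_basis_exists[OF assms(1)] by (rule someI_ex)
  then show ?thesis
    unfolding trace_on_def Let_def by (rule trace_orthonormal_basis[OF _ b])
qed

lemma trace_on_pair:
  assumes "orthonormal_basis V {e1, e2}" "e1 \<noteq> e2" "bilinear_on V b"
  shows "trace_on V b = b e1 e1 + b e2 e2"
proof -
  have "subspace V" using orthonormal_basis_facts(3)[OF assms(1)] .
  then show ?thesis
    using trace_on_eq[OF _ assms(3)] trace_orthonormal_basis[OF assms(1,3)] assms(2) by simp
qed

section \<open>Charts and tangent spaces\<close>

lemma parametrization_facts:
  assumes "parametrization M U x"
  shows "open U" "smooth_on U x" "u \<in> U \<Longrightarrow> x u \<in> M"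
    and "u \<in> U \<Longrightarrow> (x has_derivative frechet_derivative x (at u)) (at u)"
    and "u \<in> U \<Longrightarrow> linear (frechet_derivative x (at u))"
    and "u \<in> U \<Longrightarrow> inj (frechet_derivative x (at u))"
  using assms openin_subset[of "top_of_set M" "x ` U"]
  unfolding parametrization_def
  by (auto intro: smooth_on_has_derivative smooth_on_linear_derivative)

lemma surface_chart:
  assumes "surface M" "p \<in> M"
  obtains U x u where "parametrization M U x" "u \<in> U" "p = x u"
  using assms unfolding surface_def by blast

text \<open>Since the derivative of \<open>x\<close> at \<open>u\<close> is injective, \<open>x\<close> expands distances from \<open>u\<close> by at least a positive
  factor near \<open>u\<close>.  An error that is small compared with the distance in the parameter domain is
  therefore small compared with the distance in \<open>M\<close>, so that a linear left inverse of the derivative of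
  \<open>x\<close> differentiates the inverse chart.  Continuity of the inverse chart, part of the definition of a
  parametrization, is what allows such local estimates.\<close>

lemma chart_inverse_has_derivative:
  assumes par: "parametrization M U x" and u: "u \<in> U"
  shows "\<exists>y A. linear A \<and> (\<forall>a. A (frechet_derivative x (at u) a) = a) \<and>
     (\<forall>w\<in>U. y (x w) = w) \<and> (y has_derivative A) (at (x u) within M)"
proof -
  note facts = parametrization_facts[OF par]
  define L where "L = frechet_derivative x (at u)"
  have L: "(x has_derivative L) (at u)" "linear L" "inj L" unfolding L_def using facts u by auto
  obtain A where A: "linear A" "A \<circ> L = id" using linear_injective_left_inverse[OF L(2,3)] by blast
  then have AL: "A (L a) = a" for a by (metis comp_apply id_apply)
  obtain C where C: "C > 0" "\<And>z. norm (A z) \<le> C * norm z" using linear_bounded_pos[OF A(1)] by auto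
  obtain B where B: "B > 0" "\<And>a. B * norm a \<le> norm (L a)"
    using linear_inj_bounded_below_pos[OF L(2,3)] by blast
  obtain y where y: "homeomorphism U (x ` U) x y" using par unfolding parametrization_def by blast
  then have yx: "y (x w) = w" if "w \<in> U" for w using that by (simp add: homeomorphism_def)
  have "continuous_on (x ` U) y" using y by (simp add: homeomorphism_def)
  then have lim: "(y \<longlongrightarrow> u) (at (x u) within x ` U)"
    using u yx[OF u] unfolding continuous_on_def by (metis imageI)
  have "(y has_derivative A) (at (x u) within x ` U)"
    unfolding has_derivative_within_alt2
  proof (intro conjI allI impI)
    show "bounded_linear A" using A(1) by (simp add: linear_conv_bounded_linear)
    fix e :: real assume "e > 0"
    \<comment> \<open>The first bound makes \<open>x\<close> expand distances from \<open>u\<close> by the factor \<open>B / 2\<close>, the second one absorbs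
  this factor and the norm bound \<open>C\<close> of \<open>A\<close>.\<close>
    define k where "k = min (B / 2) (e * B / (2 * C))"
    have "k > 0" using \<open>e > 0\<close> B C by (simp add: k_def)
    then obtain d where "d > 0"
      and d: "\<And>w. norm (w - u) < d \<Longrightarrow> norm (x w - x u - L (w - u)) \<le> k * norm (w - u)"
      using L(1) unfolding has_derivative_at_alt by blast
    have est: "norm (w - u - A (x w - x u)) \<le> e * norm (x w - x u)" if "norm (w - u) < d" for w
    proof -
      have "B * norm (w - u) \<le> norm (x w - x u) + norm (x w - x u - L (w - u))"
        using B(2)[of "w - u"] norm_triangle_sub[of "L (w - u)" "x w - x u"]
        by (simp add: norm_minus_commute)
      also have "\<dots> \<le> norm (x w - x u) + B / 2 * norm (w - u)"
        using order_trans[OF d[OF that] mult_right_mono[of k "B / 2" "norm (w - u)"]]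
        by (simp add: min_def k_def)
      finally have 1: "B * norm (w - u) \<le> 2 * norm (x w - x u)" by simp
      have "norm (w - u - A (x w - x u)) = norm (A (x w - x u - L (w - u)))"
        by (simp add: linear_diff[OF A(1)] AL norm_minus_commute)
      also have "\<dots> \<le> C * (k * norm (w - u))"
        using C d[OF that] by (meson mult_left_mono order_less_imp_le order_trans)
      also have "\<dots> \<le> C * (e * B / (2 * C) * norm (w - u))"
        using C by (intro mult_left_mono mult_right_mono) (auto simp: k_def)
      also have "\<dots> = e / 2 * (B * norm (w - u))" using C by simp
      also have "\<dots> \<le> e / 2 * (2 * norm (x w - x u))"
        using 1 \<open>e > 0\<close> by (intro mult_left_mono) auto
      finally show ?thesis by simp
    qed
    have "\<forall>\<^sub>F q in at (x u) within x ` U. dist (y q) u < d"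
      using lim \<open>d > 0\<close> by (rule tendstoD)
    moreover have "\<forall>\<^sub>F q in at (x u) within x ` U. q \<in> x ` U"
      by (simp add: eventually_at_filter)
    ultimately show "\<forall>\<^sub>F q in at (x u) within x ` U.
        norm (y q - y (x u) - A (q - x u)) \<le> e * norm (q - x u)"
    proof eventually_elim
      case (elim q)
      then obtain w where "w \<in> U" "q = x w" by blast
      with elim show ?case using est[of w] yx u by (simp add: dist_norm)
    qed
  qed
  moreover have "at (x u) within x ` U = at (x u) within M"
  proof -
    obtain T where "open T" "x ` U = M \<inter> T"
      using par unfolding parametrization_def openin_open by blast
    then show ?thesis using u by (intro at_within_nhd[of _ T]) auto
  qed
  ultimately show ?thesis using A(1) AL yx unfolding L_def by metis
qed

text \<open>Composing \<open>f \<circ> x\<close> with the inverse chart reduces differentiability within \<open>M\<close> to the parameter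
  domain.  The linear map \<open>A\<close> is the derivative of the inverse chart.\<close>

lemma has_derivative_within_surface:
  assumes par: "parametrization M U x" and u: "u \<in> U"
    and f: "((f \<circ> x) has_derivative D) (at u)"
  shows "\<exists>A. (\<forall>a. A (frechet_derivative x (at u) a) = a) \<and>
    (f has_derivative (\<lambda>v. D (A v))) (at (x u) within M)"
proof -
  obtain y A where A: "\<And>a. A (frechet_derivative x (at u) a) = a"
    and y: "\<And>w. w \<in> U \<Longrightarrow> y (x w) = w" "(y has_derivative A) (at (x u) within M)"
    using chart_inverse_has_derivative[OF par u] by blast
  have "((\<lambda>q. (f \<circ> x) (y q)) has_derivative (\<lambda>v. D (A v))) (at (x u) within M)"
    by (rule has_derivative_compose[OF y(2)]) (use f y(1)[OF u] in \<open>simp only:\<close>)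
  moreover obtain T where T: "open T" "x ` U = M \<inter> T"
    using par unfolding parametrization_def openin_open by blast
  ultimately have "(f has_derivative (\<lambda>v. D (A v))) (at (x u) within M)"
  proof (rule_tac has_derivative_transform_eventually)
    have "\<forall>\<^sub>F q in at (x u) within M. q \<in> M \<inter> T"
      using T u by (auto simp: eventually_at_topological)
    then show "\<forall>\<^sub>F q in at (x u) within M. (f \<circ> x) (y q) = f q"
    proof eventually_elim
      case (elim q)
      then obtain w where "w \<in> U" "q = x w" using T by blast
      then show ?case using y(1) by simp
    qed
  qed (use u y(1) T in auto)
  then show ?thesis using A by blast
qed

text \<open>A derivative within \<open>M\<close> is determined on velocities of curves in \<open>M\<close>, by the chain rule.\<close>

lemma has_derivative_unique_on_tangent:
  assumes "(f has_derivative D) (at p within M)" "(f has_derivative D') (at p within M)"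
    and "v \<in> tangent_space M p"
  shows "D v = D' v"
proof -
  obtain \<gamma> e where "e > 0" and \<gamma>: "\<gamma> ` {-e<..<e} \<subseteq> M" "\<gamma> 0 = p"
    and v: "(\<gamma> has_vector_derivative v) (at (0::real))"
    using assms(3) unfolding tangent_space_def by blast
  have \<gamma>': "(\<gamma> has_derivative (\<lambda>s. s *\<^sub>R v)) (at 0 within {-e<..<e})"
    using v unfolding has_vector_derivative_def by (rule has_derivative_at_withinI)
  have "((f \<circ> \<gamma>) has_derivative (E \<circ> (\<lambda>s. s *\<^sub>R v))) (at 0)"
    if "(f has_derivative E) (at p within M)" for E
  proof -
    have "(f has_derivative E) (at (\<gamma> 0) within \<gamma> ` {-e<..<e})"
      using that \<gamma> by (auto intro: has_derivative_subset)
    from diff_chain_within[OF \<gamma>' this] show ?thesis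
      using \<open>e > 0\<close> by (simp add: at_within_open[of 0 "{-e<..<e}"])
  qed
  from has_derivative_unique[OF this[OF assms(1)] this[OF assms(2)]]
  show ?thesis by (auto simp: fun_eq_iff dest: spec[of _ "1::real"])
qed

lemma diff_eq:
  assumes "(f has_derivative D) (at p within M)" "v \<in> tangent_space M p"
  shows "diff M f p v = D v"
  unfolding diff_def
  using has_derivative_unique_on_tangent[OF _ assms] assms(1)
  by (meson differentiableI frechet_derivative_works)

text \<open>A tangent vector is fixed by the derivative within \<open>M\<close> of the identity; computed through the chart,
  that derivative takes values in the range of the derivative of \<open>x\<close>.  Conversely, the images under
  \<open>x\<close> of straight lines are curves in \<open>M\<close>.\<close>

lemma tangent_space_chart:
  assumes par: "parametrization M U x" and u: "u \<in> U"
  shows "tangent_space M (x u) = range (frechet_derivative x (at u))"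
proof (rule subset_antisym)
  note facts = parametrization_facts[OF par]
  let ?L = "frechet_derivative x (at u)"
  have "((id \<circ> x) has_derivative ?L) (at u)"
    using facts(4)[OF u] by simp
  from has_derivative_within_surface[OF par u this] obtain A where
    "(id has_derivative (\<lambda>v. ?L (A v))) (at (x u) within M)" by blast
  then have "v = ?L (A v)" if "v \<in> tangent_space M (x u)" for v
    using has_derivative_unique_on_tangent[OF has_derivative_id _ that] by simp
  then show "tangent_space M (x u) \<subseteq> range ?L" by blast
  show "range ?L \<subseteq> tangent_space M (x u)"
  proof (rule image_subsetI)
    fix a
    let ?I = "{t::real. u + t *\<^sub>R a \<in> U}"
    have "continuous_on UNIV (\<lambda>t::real. u + t *\<^sub>R a)" by (intro continuous_intros)
    then have "open ((\<lambda>t::real. u + t *\<^sub>R a) -` U)" using facts(1) open_vimage by blast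
    then have "open ?I" by (simp add: vimage_def)
    moreover have "0 \<in> ?I" using u by simp
    ultimately obtain e where e: "e > 0" "ball 0 e \<subseteq> ?I" using open_contains_ball by blast
    have I: "u + t *\<^sub>R a \<in> U" if "t \<in> {-e<..<e}" for t
      using e that by (auto simp: subset_iff dist_real_def)
    have "(x has_derivative ?L) (at (u + 0 *\<^sub>R a))" using facts(4)[OF u] by simp
    moreover have "((\<lambda>t. u + t *\<^sub>R a) has_derivative (\<lambda>s. s *\<^sub>R a)) (at (0::real))"
      by (auto intro!: derivative_eq_intros)
    ultimately have "((\<lambda>t. x (u + t *\<^sub>R a)) has_derivative (\<lambda>s. ?L (s *\<^sub>R a))) (at 0)"
      by (rule has_derivative_compose[rotated])
    then have "((\<lambda>t. x (u + t *\<^sub>R a)) has_vector_derivative ?L a) (at 0)"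
      by (simp add: has_vector_derivative_def linear_scale[OF facts(5)[OF u]])
    moreover have "smooth_on {-e<..<e} (\<lambda>t. x (u + t *\<^sub>R a))"
      by (rule smooth_on_affine_line[OF facts(2)]) (use I in auto)
    ultimately show "?L a \<in> tangent_space M (x u)"
      unfolding tangent_space_def using e(1) I facts(3)
      by (intro CollectI exI[of _ "\<lambda>t. x (u + t *\<^sub>R a)"] exI[of _ e]) auto
  qed
qed

lemma subspace_tangent_space:
  assumes "surface M" "p \<in> M"
  shows "subspace (tangent_space M p)"
proof -
  obtain U x u where par: "parametrization M U x" and u: "u \<in> U" "p = x u"
    using surface_chart assms by blast
  show ?thesis
    unfolding u(2) tangent_space_chart[OF par u(1)]
    using parametrization_facts(5)[OF par u(1)] by (rule linear_subspace_image[OF _ subspace_UNIV])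
qed

abbreviation pd1 :: "(real^2 \<Rightarrow> 'b::euclidean_space) \<Rightarrow> real^2 \<Rightarrow> 'b" where
  "pd1 f u \<equiv> frechet_derivative f (at u) (axis 1 1)"

abbreviation pd2 :: "(real^2 \<Rightarrow> 'b::euclidean_space) \<Rightarrow> real^2 \<Rightarrow> 'b" where
  "pd2 f u \<equiv> frechet_derivative f (at u) (axis 2 1)"

lemma vec2_eq: "(a::real^2) = (a $ 1) *\<^sub>R axis 1 1 + (a $ 2) *\<^sub>R axis 2 1"
  by (simp add: vec_eq_iff forall_2 axis_def)

lemma linear_vec2: "linear L \<Longrightarrow> L (a::real^2) = (a $ 1) *\<^sub>R L (axis 1 1) + (a $ 2) *\<^sub>R L (axis 2 1)"
  by (subst vec2_eq[of a]) (simp only: linear_add linear_scale)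

lemma tangent_space_chart_coordinates:
  assumes "parametrization M U x" "u \<in> U"
  shows "tangent_space M (x u) = {a *\<^sub>R pd1 x u + b *\<^sub>R pd2 x u | a b. True}"
proof -
  have lin: "linear (frechet_derivative x (at u))" using parametrization_facts assms by blast
  have "range (frechet_derivative x (at u)) = {a *\<^sub>R pd1 x u + b *\<^sub>R pd2 x u | a b. True}"
  proof safe
    fix a show "\<exists>c d. frechet_derivative x (at u) a = c *\<^sub>R pd1 x u + d *\<^sub>R pd2 x u \<and> True"
      using linear_vec2[OF lin, of a] by blast
  next
    fix a b
    have "a *\<^sub>R pd1 x u + b *\<^sub>R pd2 x u =
        frechet_derivative x (at u) (a *\<^sub>R axis 1 1 + b *\<^sub>R axis 2 1)"
      by (simp add: linear_add[OF lin] linear_scale[OF lin])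
    then show "a *\<^sub>R pd1 x u + b *\<^sub>R pd2 x u \<in> range (frechet_derivative x (at u))" by simp
  qed
  then show ?thesis using tangent_space_chart[OF assms] by simp
qed

text \<open>If the Gram determinant \<open>E G - F\<^sup>2\<close> were not positive, the linear combination \<open>G x\<^sub>1 - F x\<^sub>2\<close> of the
  coordinate vectors would vanish, since its square is \<open>G (E G - F\<^sup>2)\<close>.\<close>

lemma gram_determinant_pos:
  assumes "parametrization M U x" "u \<in> U"
  shows "(pd1 x u \<bullet> pd1 x u) * (pd2 x u \<bullet> pd2 x u) - (pd1 x u \<bullet> pd2 x u)\<^sup>2 > 0"
proof (rule ccontr)
  let ?x1 = "pd1 x u" and ?x2 = "pd2 x u"
  note facts = parametrization_facts[OF assms(1)]
  have lin: "linear (frechet_derivative x (at u))" and inj: "inj (frechet_derivative x (at u))"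
    using facts assms by blast+
  have indep: "a = 0 \<and> b = 0" if "a *\<^sub>R ?x1 + b *\<^sub>R ?x2 = 0" for a b
  proof -
    have "frechet_derivative x (at u) (a *\<^sub>R axis 1 1 + b *\<^sub>R axis 2 1) = 0"
      using that by (simp add: linear_add[OF lin] linear_scale[OF lin])
    then have "a *\<^sub>R axis 1 1 + b *\<^sub>R axis 2 1 = (0::real^2)"
      using inj lin by (metis linear_injective_0)
    then show ?thesis by (simp add: vec_eq_iff forall_2 axis_def)
  qed
  assume neg: "\<not> ?thesis"
  let ?z = "(?x2 \<bullet> ?x2) *\<^sub>R ?x1 + (- (?x1 \<bullet> ?x2)) *\<^sub>R ?x2"
  have "?z \<bullet> ?z = (?x2 \<bullet> ?x2) * ((?x1 \<bullet> ?x1) * (?x2 \<bullet> ?x2) - (?x1 \<bullet> ?x2)\<^sup>2)"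
    by (simp add: inner_simps algebra_simps power2_eq_square inner_commute)
  also have "\<dots> \<le> 0" using neg by (intro mult_nonneg_nonpos) auto
  finally have "?z = 0" by (metis inner_gt_zero_iff not_le)
  then have "?x2 \<bullet> ?x2 = 0" using indep by blast
  then have "0 *\<^sub>R ?x1 + 1 *\<^sub>R ?x2 = 0" by simp
  then show False using indep by fastforce
qed

lemma smooth_map_differentiable:
  assumes "surface M" "smooth_map M f" "p \<in> M"
  shows "f differentiable (at p within M)"
proof -
  obtain U x u where par: "parametrization M U x" and u: "u \<in> U" "p = x u"
    using surface_chart assms by blast
  then have "((f \<circ> x) has_derivative frechet_derivative (f \<circ> x) (at u)) (at u)"
    using assms(2) unfolding smooth_map_def by (blast intro: smooth_on_has_derivative)
  from has_derivative_within_surface[OF par u(1) this] show ?thesis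
    unfolding differentiable_def u(2) by blast
qed

lemma diff_chart:
  assumes par: "parametrization M U x" and u: "u \<in> U" and f: "(f \<circ> x) differentiable at u"
  shows "diff M f (x u) (a *\<^sub>R pd1 x u + b *\<^sub>R pd2 x u) = a *\<^sub>R pd1 (f \<circ> x) u + b *\<^sub>R pd2 (f \<circ> x) u"
proof -
  let ?L = "frechet_derivative x (at u)" and ?c = "a *\<^sub>R axis 1 1 + b *\<^sub>R axis 2 1 :: real^2"
  have lin: "linear ?L" using parametrization_facts[OF par] u by blast
  have D: "((f \<circ> x) has_derivative frechet_derivative (f \<circ> x) (at u)) (at u)"
    using f by (simp add: frechet_derivative_works)
  obtain A where A: "\<And>a. A (?L a) = a"
    and fA: "(f has_derivative (\<lambda>v. frechet_derivative (f \<circ> x) (at u) (A v))) (at (x u) within M)"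
    using has_derivative_within_surface[OF par u D] by blast
  have "a *\<^sub>R pd1 x u + b *\<^sub>R pd2 x u = ?L ?c"
    by (simp add: linear_add[OF lin] linear_scale[OF lin])
  moreover have "?L ?c \<in> tangent_space M (x u)" using tangent_space_chart[OF par u] by simp
  ultimately have "diff M f (x u) (a *\<^sub>R pd1 x u + b *\<^sub>R pd2 x u) = frechet_derivative (f \<circ> x) (at u) ?c"
    using diff_eq[OF fA] A by simp
  also have "\<dots> = a *\<^sub>R pd1 (f \<circ> x) u + b *\<^sub>R pd2 (f \<circ> x) u"
    using has_derivative_linear[OF D] by (simp add: linear_add linear_scale)
  finally show ?thesis .
qed

section \<open>Vector fields and Lie brackets\<close>

abbreviation tproj :: "'a::euclidean_space set \<Rightarrow> 'a \<Rightarrow> 'a \<Rightarrow> 'a" where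
  "tproj M p \<equiv> proj (tangent_space M p)"

text \<open>Solving the normal equations by Cramer's rule, the coordinates of a tangential projection are
  rational functions of inner products, with the Gram determinant as denominator.\<close>

lemma tproj_chart_coordinates:
  assumes M: "surface M" and par: "parametrization M U x" and W: "smooth_on U W"
  shows "\<exists>a b. smooth_on U a \<and> smooth_on U b \<and>
    (\<forall>u\<in>U. tproj M (x u) (W u) = a u *\<^sub>R pd1 x u + b u *\<^sub>R pd2 x u)"
proof -
  note facts = parametrization_facts[OF par]
  define \<Delta> where "\<Delta> u = (pd1 x u \<bullet> pd1 x u) * (pd2 x u \<bullet> pd2 x u) - (pd1 x u \<bullet> pd2 x u) * (pd1 x u \<bullet> pd2 x u)" for u
  have \<Delta>: "\<Delta> u \<noteq> 0" if "u \<in> U" for u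
    using gram_determinant_pos[OF par that] by (simp add: \<Delta>_def power2_eq_square)
  define a where "a u = ((pd2 x u \<bullet> pd2 x u) * (W u \<bullet> pd1 x u) - (pd1 x u \<bullet> pd2 x u) * (W u \<bullet> pd2 x u)) / \<Delta> u" for u
  define b where "b u = ((pd1 x u \<bullet> pd1 x u) * (W u \<bullet> pd2 x u) - (pd1 x u \<bullet> pd2 x u) * (W u \<bullet> pd1 x u)) / \<Delta> u" for u
  have "smooth_on U a" "smooth_on U b"
    unfolding a_def b_def \<Delta>_def using \<Delta> unfolding \<Delta>_def
    by (intro smooth_intros facts W; assumption)+
  moreover have "tproj M (x u) (W u) = a u *\<^sub>R pd1 x u + b u *\<^sub>R pd2 x u" if uU: "u \<in> U" for u
  proof (rule proj_eqI)
    show "subspace (tangent_space M (x u))"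
      using M facts uU by (blast intro: subspace_tangent_space)
    show "a u *\<^sub>R pd1 x u + b u *\<^sub>R pd2 x u \<in> tangent_space M (x u)"
      using tangent_space_chart_coordinates[OF par uU] by blast
    fix s assume "s \<in> tangent_space M (x u)"
    then obtain c d where s: "s = c *\<^sub>R pd1 x u + d *\<^sub>R pd2 x u"
      using tangent_space_chart_coordinates[OF par uU] by blast
    let ?E = "pd1 x u \<bullet> pd1 x u" and ?F = "pd1 x u \<bullet> pd2 x u" and ?G = "pd2 x u \<bullet> pd2 x u"
    have a: "a u * \<Delta> u = ?G * (W u \<bullet> pd1 x u) - ?F * (W u \<bullet> pd2 x u)"
      and b: "b u * \<Delta> u = ?E * (W u \<bullet> pd2 x u) - ?F * (W u \<bullet> pd1 x u)"
      using \<Delta>[OF uU] by (simp_all add: a_def b_def)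
    have "\<Delta> u * (a u * ?E + b u * ?F) = \<Delta> u * (W u \<bullet> pd1 x u)"
      using a b unfolding \<Delta>_def by algebra
    then have 1: "(W u - (a u *\<^sub>R pd1 x u + b u *\<^sub>R pd2 x u)) \<bullet> pd1 x u = 0"
      using \<Delta>[OF uU] by (simp add: inner_simps inner_commute)
    have "\<Delta> u * (a u * ?F + b u * ?G) = \<Delta> u * (W u \<bullet> pd2 x u)"
      using a b unfolding \<Delta>_def by algebra
    then have 2: "(W u - (a u *\<^sub>R pd1 x u + b u *\<^sub>R pd2 x u)) \<bullet> pd2 x u = 0"
      using \<Delta>[OF uU] by (simp add: inner_simps inner_commute)
    show "(W u - (a u *\<^sub>R pd1 x u + b u *\<^sub>R pd2 x u)) \<bullet> s = 0"
      unfolding s inner_add_right inner_scaleR_right 1 2 by simp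
  qed
  ultimately show ?thesis by blast
qed

lemma smooth_map_cong:
  assumes "smooth_map M f" "\<And>q. q \<in> M \<Longrightarrow> f q = g q"
  shows "smooth_map M g"
  unfolding smooth_map_def
proof (intro allI impI)
  fix U x assume par: "parametrization M U x"
  show "smooth_on U (g \<circ> x)"
    by (rule smooth_on_cong[of U "f \<circ> x"])
      (use assms par parametrization_facts[OF par] in \<open>auto simp: smooth_map_def\<close>)
qed

lemma smooth_map_const: "smooth_map M (\<lambda>q. c)"
  and smooth_map_ident: "smooth_map M (\<lambda>q. q)"
  and smooth_map_diff: "smooth_map M f \<Longrightarrow> smooth_map M g \<Longrightarrow> smooth_map M (\<lambda>q. f q - g q)"
  and smooth_map_scaleR: "smooth_map M h \<Longrightarrow> smooth_map M g \<Longrightarrow> smooth_map M (\<lambda>q. h q *\<^sub>R g q)"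
  and smooth_map_inner: "smooth_map M f \<Longrightarrow> smooth_map M g \<Longrightarrow> smooth_map M (\<lambda>q. f q \<bullet> g q)"
  and smooth_map_sum: "(\<And>i. i \<in> A \<Longrightarrow> smooth_map M (F i)) \<Longrightarrow> smooth_map M (\<lambda>q. \<Sum>i\<in>A. F i q)"
  unfolding smooth_map_def o_def by (auto intro!: smooth_intros dest: parametrization_facts)

lemma vector_field_tproj:
  assumes M: "surface M" and W: "smooth_map M W"
  shows "vector_field M (\<lambda>q. tproj M q (W q))"
  unfolding vector_field_def smooth_map_def
proof (intro conjI allI impI ballI)
  fix U x assume par: "parametrization M U x"
  note facts = parametrization_facts[OF par]
  have "smooth_on U (\<lambda>u. W (x u))" using W par unfolding smooth_map_def o_def by blast
  from tproj_chart_coordinates[OF M par this] obtain a b where ab: "smooth_on U a" "smooth_on U b"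
    and eq: "\<forall>u\<in>U. tproj M (x u) (W (x u)) = a u *\<^sub>R pd1 x u + b u *\<^sub>R pd2 x u" by blast
  have "smooth_on U (\<lambda>u. a u *\<^sub>R pd1 x u + b u *\<^sub>R pd2 x u)"
    by (intro smooth_intros facts ab)
  from smooth_on_cong[OF facts(1) this] show "smooth_on U ((\<lambda>q. tproj M q (W q)) \<circ> x)"
    using eq by simp
next
  show "tproj M p (W p) \<in> tangent_space M p" if "p \<in> M" for p
    using proj_in subspace_tangent_space M that by blast
qed

lemma vector_fieldD:
  assumes "vector_field M X"
  shows "smooth_map M X" "p \<in> M \<Longrightarrow> X p \<in> tangent_space M p"
  using assms by (auto simp: vector_field_def)

text \<open>Projecting a constant vector to all the tangent spaces extends a tangent vector to a global vector
  field, without recourse to cut-off functions.\<close>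

lemma vector_field_extension:
  assumes "surface M" "p \<in> M" "v \<in> tangent_space M p"
  shows "vector_field M (\<lambda>q. tproj M q v)" "tproj M p v = v"
  using assms by (auto intro: vector_field_tproj smooth_map_const proj_id subspace_tangent_space)

lemma vector_field_chart_coordinates:
  assumes M: "surface M" and par: "parametrization M U x" and X: "vector_field M X"
  shows "\<exists>a b. smooth_on U a \<and> smooth_on U b \<and>
    (\<forall>u\<in>U. X (x u) = a u *\<^sub>R pd1 x u + b u *\<^sub>R pd2 x u)"
proof -
  have "smooth_on U (\<lambda>u. X (x u))"
    using X par unfolding vector_field_def smooth_map_def o_def by blast
  moreover have "tproj M (x u) (X (x u)) = X (x u)" if "u \<in> U" for u
    using parametrization_facts(3)[OF par that] M X
    by (auto intro: proj_id subspace_tangent_space vector_fieldD)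
  ultimately show ?thesis using tproj_chart_coordinates[OF M par] by metis
qed

text \<open>The derivative within \<open>M\<close> is chosen among all the linear maps that satisfy the defining condition,
  and that condition only involves values on \<open>M\<close>.\<close>

lemma diff_cong:
  assumes "\<And>q. q \<in> M \<Longrightarrow> f q = g q" "p \<in> M"
  shows "diff M f p = diff M g p"
proof -
  have "(f has_derivative D) (at p within M) = (g has_derivative D) (at p within M)" for D
    using has_derivative_transform[OF assms(2), of f g D] has_derivative_transform[OF assms(2), of g f D]
      assms(1) by auto
  then show ?thesis unfolding diff_def frechet_derivative_def fun_eq_iff by simp
qed

lemma differentiable_has_diff:
  "f differentiable (at p within M) \<Longrightarrow> (f has_derivative diff M f p) (at p within M)"
  unfolding diff_def using frechet_derivative_works by blast

lemma linear_diff_map: "f differentiable (at p within M) \<Longrightarrow> linear (diff M f p)"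
  using differentiable_has_diff has_derivative_linear by blast

lemma
  assumes "v \<in> tangent_space M p"
    and f: "f differentiable (at p within M)" and g: "g differentiable (at p within M)"
  shows diff_add: "diff M (\<lambda>q. f q + g q) p v = diff M f p v + diff M g p v"
    and diff_inner: "diff M (\<lambda>q. f q \<bullet> g q) p v = diff M f p v \<bullet> g p + f p \<bullet> diff M g p v"
  using diff_eq[OF has_derivative_add[OF differentiable_has_diff[OF f] differentiable_has_diff[OF g]]]
    diff_eq[OF has_derivative_inner[OF differentiable_has_diff[OF f] differentiable_has_diff[OF g]]]
    assms(1) by (auto simp: add.commute)

lemma diff_scaleR:
  assumes "v \<in> tangent_space M p"
    and f: "f differentiable (at p within M)" and g: "g differentiable (at p within M)"
  shows "diff M (\<lambda>q. f q *\<^sub>R g q) p v = diff M f p v *\<^sub>R g p + f p *\<^sub>R diff M g p v"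
  using diff_eq[OF has_derivative_scaleR[OF differentiable_has_diff[OF f] differentiable_has_diff[OF g]]]
    assms(1) by (auto simp: add.commute)

lemma diff_inner_const:
  assumes "v \<in> tangent_space M p" and f: "f differentiable (at p within M)"
  shows "diff M (\<lambda>q. f q \<bullet> c) p v = diff M f p v \<bullet> c"
  using diff_eq[OF has_derivative_inner_left[OF differentiable_has_diff[OF f]]] assms(1) by blast

lemma diff_ident: "v \<in> tangent_space M p \<Longrightarrow> diff M (\<lambda>q. q) p v = v"
  using diff_eq[OF has_derivative_ident] .

lemma smooth_map_directional_derivative:
  assumes M: "surface M" and f: "smooth_map M f" and X: "vector_field M X"
  shows "smooth_map M (\<lambda>p. diff M f p (X p))"
  unfolding smooth_map_def
proof (intro allI impI)
  fix U x assume par: "parametrization M U x"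
  note facts = parametrization_facts[OF par]
  have fx: "smooth_on U (f \<circ> x)" using f par unfolding smooth_map_def by blast
  obtain a b where ab: "smooth_on U a" "smooth_on U b"
    and eq: "\<forall>u\<in>U. X (x u) = a u *\<^sub>R pd1 x u + b u *\<^sub>R pd2 x u"
    using vector_field_chart_coordinates[OF M par X] by blast
  have "smooth_on U (\<lambda>u. a u *\<^sub>R pd1 (f \<circ> x) u + b u *\<^sub>R pd2 (f \<circ> x) u)"
    by (intro smooth_intros facts ab fx)
  then show "smooth_on U ((\<lambda>p. diff M f p (X p)) \<circ> x)"
    by (rule smooth_on_cong[OF facts(1)])
      (use eq diff_chart[OF par _ differentiableI[OF smooth_on_has_derivative[OF fx]]] in simp)
qed

text \<open>In a chart, the second derivatives of \<open>f\<close> cancel in \<open>X (Y f) - Y (X f)\<close> by symmetry, and the first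
  derivatives of the coefficients remain as the coordinates of the Lie bracket.\<close>

lemma lie_derivative_commutator:
  fixes M :: "'a::euclidean_space set"
  assumes M: "surface M" and X: "vector_field M X" and Y: "vector_field M Y" and p: "p \<in> M"
  shows "\<exists>t\<in>tangent_space M p. \<forall>f::'a \<Rightarrow> real. smooth_map M f \<longrightarrow>
    diff M (\<lambda>q. diff M f q (Y q)) p (X p) - diff M (\<lambda>q. diff M f q (X q)) p (Y p) = diff M f p t"
proof -
  obtain U x u where par: "parametrization M U x" and u: "u \<in> U" and pu: "p = x u"
    using surface_chart M p by blast
  note facts = parametrization_facts[OF par]
  obtain a1 a2 where a: "smooth_on U a1" "smooth_on U a2"
    and Xeq: "\<And>w. w \<in> U \<Longrightarrow> X (x w) = a1 w *\<^sub>R pd1 x w + a2 w *\<^sub>R pd2 x w"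
    using vector_field_chart_coordinates[OF M par X] by blast
  obtain b1 b2 where b: "smooth_on U b1" "smooth_on U b2"
    and Yeq: "\<And>w. w \<in> U \<Longrightarrow> Y (x w) = b1 w *\<^sub>R pd1 x w + b2 w *\<^sub>R pd2 x w"
    using vector_field_chart_coordinates[OF M par Y] by blast
  define c1 where "c1 = a1 u * pd1 b1 u + a2 u * pd2 b1 u - b1 u * pd1 a1 u - b2 u * pd2 a1 u"
  define c2 where "c2 = a1 u * pd1 b2 u + a2 u * pd2 b2 u - b1 u * pd1 a2 u - b2 u * pd2 a2 u"
  have "diff M (\<lambda>q. diff M f q (Y q)) p (X p) - diff M (\<lambda>q. diff M f q (X q)) p (Y p) =
      diff M f p (c1 *\<^sub>R pd1 x u + c2 *\<^sub>R pd2 x u)"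
    if f: "smooth_map M f" for f :: "'a \<Rightarrow> real"
  proof -
    have F: "smooth_on U (f \<circ> x)" using f par unfolding smooth_map_def by blast
    have F1: "smooth_on U (pd1 (f \<circ> x))" and F2: "smooth_on U (pd2 (f \<circ> x))"
      using F by (intro smooth_intros; assumption)+
    have comp: "diff M (\<lambda>q. diff M f q (Z q)) p (d1 *\<^sub>R pd1 x u + d2 *\<^sub>R pd2 x u) =
        d1 * (pd1 h1 u * pd1 (f \<circ> x) u + h1 u * pd1 (pd1 (f \<circ> x)) u +
              (pd1 h2 u * pd2 (f \<circ> x) u + h2 u * pd1 (pd2 (f \<circ> x)) u)) +
        d2 * (pd2 h1 u * pd1 (f \<circ> x) u + h1 u * pd2 (pd1 (f \<circ> x)) u +
              (pd2 h2 u * pd2 (f \<circ> x) u + h2 u * pd2 (pd2 (f \<circ> x)) u))"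
      if h: "smooth_on U h1" "smooth_on U h2"
        and Z: "\<And>w. w \<in> U \<Longrightarrow> Z (x w) = h1 w *\<^sub>R pd1 x w + h2 w *\<^sub>R pd2 x w" for Z h1 h2 d1 d2
    proof -
      let ?ZF = "(\<lambda>q. diff M f q (Z q)) \<circ> x"
      have eq: "h1 w * pd1 (f \<circ> x) w + h2 w * pd2 (f \<circ> x) w = ?ZF w" if "w \<in> U" for w
        using diff_chart[OF par that differentiableI[OF smooth_on_has_derivative[OF F that]]] Z[OF that] by simp
      have "((\<lambda>w. h1 w * pd1 (f \<circ> x) w + h2 w * pd2 (f \<circ> x) w) has_derivative
         (\<lambda>v. (h1 u * frechet_derivative (pd1 (f \<circ> x)) (at u) v + frechet_derivative h1 (at u) v * pd1 (f \<circ> x) u) +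
             (h2 u * frechet_derivative (pd2 (f \<circ> x)) (at u) v + frechet_derivative h2 (at u) v * pd2 (f \<circ> x) u))) (at u)"
        by (intro has_derivative_add has_derivative_mult smooth_on_has_derivative[OF _ u] h F1 F2)
      then have D: "(?ZF has_derivative
         (\<lambda>v. (h1 u * frechet_derivative (pd1 (f \<circ> x)) (at u) v + frechet_derivative h1 (at u) v * pd1 (f \<circ> x) u) +
             (h2 u * frechet_derivative (pd2 (f \<circ> x)) (at u) v + frechet_derivative h2 (at u) v * pd2 (f \<circ> x) u))) (at u)"
        using facts(1) u eq by (rule has_derivative_transform_within_open)
      show ?thesis
        unfolding pu diff_chart[OF par u differentiableI[OF D]] frechet_derivative_at[OF D, symmetric]
        by (simp add: algebra_simps)
    qed
    have sym: "pd2 (pd1 (f \<circ> x)) u = pd1 (pd2 (f \<circ> x)) u"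
      using mixed_partial_derivatives_commute[OF F facts(1) u] .
    have Xp: "X p = a1 u *\<^sub>R pd1 x u + a2 u *\<^sub>R pd2 x u" and Yp: "Y p = b1 u *\<^sub>R pd1 x u + b2 u *\<^sub>R pd2 x u"
      using Xeq Yeq u pu by auto
    have R: "diff M f p (c1 *\<^sub>R pd1 x u + c2 *\<^sub>R pd2 x u) = c1 * pd1 (f \<circ> x) u + c2 * pd2 (f \<circ> x) u"
      unfolding pu using diff_chart[OF par u differentiableI[OF smooth_on_has_derivative[OF F u]]] by simp
    have XY: "diff M (\<lambda>q. diff M f q (Y q)) p (X p) =
        a1 u * (pd1 b1 u * pd1 (f \<circ> x) u + b1 u * pd1 (pd1 (f \<circ> x)) u +
              (pd1 b2 u * pd2 (f \<circ> x) u + b2 u * pd1 (pd2 (f \<circ> x)) u)) +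
        a2 u * (pd2 b1 u * pd1 (f \<circ> x) u + b1 u * pd1 (pd2 (f \<circ> x)) u +
              (pd2 b2 u * pd2 (f \<circ> x) u + b2 u * pd2 (pd2 (f \<circ> x)) u))"
      unfolding Xp using comp[OF b, of Y "a1 u" "a2 u"] Yeq sym by simp
    have YX: "diff M (\<lambda>q. diff M f q (X q)) p (Y p) =
        b1 u * (pd1 a1 u * pd1 (f \<circ> x) u + a1 u * pd1 (pd1 (f \<circ> x)) u +
              (pd1 a2 u * pd2 (f \<circ> x) u + a2 u * pd1 (pd2 (f \<circ> x)) u)) +
        b2 u * (pd2 a1 u * pd1 (f \<circ> x) u + a1 u * pd1 (pd2 (f \<circ> x)) u +
              (pd2 a2 u * pd2 (f \<circ> x) u + a2 u * pd2 (pd2 (f \<circ> x)) u))"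
      unfolding Yp using comp[OF a, of X "b1 u" "b2 u"] Xeq sym by simp
    show ?thesis
      unfolding XY YX R unfolding c1_def c2_def by algebra
  qed
  moreover have "c1 *\<^sub>R pd1 x u + c2 *\<^sub>R pd2 x u \<in> tangent_space M p"
    using tangent_space_chart_coordinates[OF par u] pu by blast
  ultimately show ?thesis by blast
qed

lemma vector_field_differentiable:
  "surface M \<Longrightarrow> vector_field M X \<Longrightarrow> p \<in> M \<Longrightarrow> X differentiable (at p within M)"
  using smooth_map_differentiable vector_fieldD(1) by blast

text \<open>Testing the commutator on linear functions identifies the bracket with the difference of the two
  ambient derivatives, which is therefore tangent to \<open>M\<close>.  This gives both the torsion of the
  tangential connection and the symmetry of the second fundamental form.\<close>

lemma lie_bracket:
  fixes M :: "'a::euclidean_space set" and f :: "'a \<Rightarrow> real"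
  assumes M: "surface M" and X: "vector_field M X" and Y: "vector_field M Y" and p: "p \<in> M"
  shows lie_bracket_tangent: "diff M Y p (X p) - diff M X p (Y p) \<in> tangent_space M p"
    and "smooth_map M f \<Longrightarrow>
      diff M f p (diff M Y p (X p) - diff M X p (Y p)) =
      diff M (\<lambda>q. diff M f q (Y q)) p (X p) - diff M (\<lambda>q. diff M f q (X q)) p (Y p)"
proof -
  obtain t where t: "t \<in> tangent_space M p" and tf: "\<And>f::'a \<Rightarrow> real. smooth_map M f \<Longrightarrow>
    diff M (\<lambda>q. diff M f q (Y q)) p (X p) - diff M (\<lambda>q. diff M f q (X q)) p (Y p) = diff M f p t"
    using lie_derivative_commutator[OF assms] by blast
  have id: "diff M (\<lambda>q. q \<bullet> c) q v = v \<bullet> c" if "v \<in> tangent_space M q" for c q v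
    using diff_inner_const[OF that, of "\<lambda>q. q"] diff_ident[OF that] by simp
  have lin: "diff M (\<lambda>q. diff M (\<lambda>q. q \<bullet> c) q (Z q)) p (W p) = diff M Z p (W p) \<bullet> c"
    if "vector_field M Z" "vector_field M W" for Z W c
  proof -
    have "diff M (\<lambda>q. diff M (\<lambda>q. q \<bullet> c) q (Z q)) p = diff M (\<lambda>q. Z q \<bullet> c) p"
      by (rule diff_cong[OF _ p]) (intro id vector_fieldD(2)[OF that(1)])
    then show ?thesis
      using diff_inner_const[of "W p" M p Z c] that M p vector_fieldD vector_field_differentiable by metis
  qed
  have "(diff M Y p (X p) - diff M X p (Y p)) \<bullet> c = t \<bullet> c" for c
    using tf[of "\<lambda>q. q \<bullet> c"] lin[OF Y X] lin[OF X Y] id[OF t]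
    by (simp add: smooth_map_inner smooth_map_ident smooth_map_const inner_diff_left)
  then have eq: "diff M Y p (X p) - diff M X p (Y p) = t"
    by (metis vector_eq_rdot)
  show "diff M Y p (X p) - diff M X p (Y p) \<in> tangent_space M p" using eq t by simp
  show "smooth_map M f \<Longrightarrow> diff M f p (diff M Y p (X p) - diff M X p (Y p)) =
      diff M (\<lambda>q. diff M f q (Y q)) p (X p) - diff M (\<lambda>q. diff M f q (X q)) p (Y p)"
    unfolding eq using tf by metis
qed

section \<open>The Levi-Civita connection of a surface\<close>

definition tangential_connection ::
  "'a::euclidean_space set \<Rightarrow> ('a \<Rightarrow> 'a) \<Rightarrow> ('a \<Rightarrow> 'a) \<Rightarrow> 'a \<Rightarrow> 'a" where
  "tangential_connection M X Y p = tproj M p (diff M Y p (X p))"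

lemma tproj_linear:
  assumes "surface M" "p \<in> M"
  shows "tproj M p (v + w) = tproj M p v + tproj M p w"
    and "tproj M p (v - w) = tproj M p v - tproj M p w"
    and "tproj M p (c *\<^sub>R v) = c *\<^sub>R tproj M p v"
  using linear_proj[OF subspace_tangent_space[OF assms]]
  by (simp_all add: linear_add linear_diff linear_scale)

lemma tproj_tangent: "surface M \<Longrightarrow> p \<in> M \<Longrightarrow> v \<in> tangent_space M p \<Longrightarrow> tproj M p v = v"
  using proj_id subspace_tangent_space by blast

lemma tproj_in: "surface M \<Longrightarrow> p \<in> M \<Longrightarrow> tproj M p v \<in> tangent_space M p"
  using proj_in subspace_tangent_space by blast

lemma tproj_inner:
  assumes "surface M" "p \<in> M" "v \<in> tangent_space M p"
  shows "tproj M p w \<bullet> v = w \<bullet> v" "v \<bullet> tproj M p w = v \<bullet> w"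
  using proj_inner subspace_tangent_space assms by blast+

text \<open>The Leibniz rule and compatibility with the metric are those of the ambient derivative, since
  projecting does not change inner products with tangent vectors.  Vanishing torsion is the tangency
  of the Lie bracket.\<close>

lemma tangential_connection_levi_civita:
  assumes M: "surface M"
  shows "affine_connection M (tangential_connection M)"
    and "torsion_free M (tangential_connection M)"
    and "metric_connection M (tangential_connection M)"
proof -
  note vfd = vector_field_differentiable[OF M] and vfT = vector_fieldD(2)
  show "affine_connection M (tangential_connection M)"
    unfolding affine_connection_def
  proof (intro conjI allI impI ballI)
    fix X Y assume "vector_field M X" "vector_field M Y"
    then show "vector_field M (tangential_connection M X Y)"
      unfolding tangential_connection_def[abs_def]
      by (intro vector_field_tproj smooth_map_directional_derivative M vector_fieldD(1))
  next
    fix X X' Y p assume "vector_field M X" "vector_field M X'" "vector_field M Y" "p \<in> M"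
    then show "tangential_connection M (\<lambda>q. X q + X' q) Y p =
        tangential_connection M X Y p + tangential_connection M X' Y p"
      and "tangential_connection M Y (\<lambda>q. X q + X' q) p =
        tangential_connection M Y X p + tangential_connection M Y X' p"
      unfolding tangential_connection_def
      using linear_diff_map[OF vfd[of Y p]]
      by (simp_all add: linear_add tproj_linear M diff_add vfd vfT)
  next
    fix f :: "'a \<Rightarrow> real" and X Y p
    assume "smooth_map M f" "vector_field M X" "vector_field M Y" "p \<in> M"
    then show "tangential_connection M (\<lambda>q. f q *\<^sub>R X q) Y p = f p *\<^sub>R tangential_connection M X Y p"
      and "tangential_connection M X (\<lambda>q. f q *\<^sub>R Y q) p =
         diff M f p (X p) *\<^sub>R Y p + f p *\<^sub>R tangential_connection M X Y p"
      unfolding tangential_connection_def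
      using linear_diff_map[OF vfd[of Y p]] smooth_map_differentiable[OF M, of f p]
      by (simp_all add: linear_scale tproj_linear M diff_scaleR vfd vfT tproj_tangent)
  qed
  show "torsion_free M (tangential_connection M)"
    unfolding torsion_free_def
  proof (intro allI impI ballI)
    fix X Y and f :: "'a \<Rightarrow> real" and p
    assume *: "vector_field M X" "vector_field M Y" "smooth_map M f" "p \<in> M"
    have "tangential_connection M X Y p - tangential_connection M Y X p =
        diff M Y p (X p) - diff M X p (Y p)"
      unfolding tangential_connection_def tproj_linear(2)[OF M \<open>p \<in> M\<close>, symmetric]
      by (rule tproj_tangent[OF M \<open>p \<in> M\<close> lie_bracket_tangent[OF M *(1,2,4)]])
    then show "diff M f p (tangential_connection M X Y p - tangential_connection M Y X p) =
      diff M (\<lambda>q. diff M f q (Y q)) p (X p) - diff M (\<lambda>q. diff M f q (X q)) p (Y p)"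
      using lie_bracket(2)[OF M *(1,2,4,3)] by simp
  qed
  show "metric_connection M (tangential_connection M)"
    unfolding metric_connection_def tangential_connection_def
    by (auto simp: diff_inner vfd vfT tproj_inner M)
qed

text \<open>The algebra of the uniqueness of the Levi-Civita connection: the difference of two such connections
  is symmetric in its first two arguments and skew in the last two.\<close>

lemma symmetric_skew_trilinear_zero:
  fixes s :: "'a \<Rightarrow> 'a \<Rightarrow> 'a \<Rightarrow> real"
  assumes "\<And>x y z. x \<in> A \<Longrightarrow> y \<in> A \<Longrightarrow> z \<in> A \<Longrightarrow> s x y z = s y x z"
    and "\<And>x y z. x \<in> A \<Longrightarrow> y \<in> A \<Longrightarrow> z \<in> A \<Longrightarrow> s x y z = - s x z y"
    and "x \<in> A" "y \<in> A" "z \<in> A"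
  shows "s x y z = 0"
proof -
  have "s x y z = - s x z y" using assms by blast
  also have "\<dots> = - s z x y" using assms(1)[of x z y] assms(3-5) by simp
  also have "\<dots> = s z y x" using assms(2)[of z x y] assms(3-5) by simp
  also have "\<dots> = s y z x" using assms(1)[of z y x] assms(3-5) by simp
  also have "\<dots> = - s y x z" using assms(2)[of y z x] assms(3-5) by simp
  also have "\<dots> = - s x y z" using assms(1)[of y x z] assms(3-5) by simp
  finally show ?thesis by simp
qed

lemma levi_civita_eq_tangential_connection:
  assumes M: "surface M" and X: "vector_field M X" and Y: "vector_field M Y" and p: "p \<in> M"
  shows "levi_civita M X Y p = tangential_connection M X Y p"
proof -
  define D where "D = levi_civita M"
  let ?D0 = "tangential_connection M"
  have "affine_connection M D \<and> torsion_free M D \<and> metric_connection M D"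
    unfolding D_def levi_civita_def
    by (rule someI[of _ ?D0]) (use tangential_connection_levi_civita[OF M] in blast)
  then have aff: "affine_connection M D" and tor: "torsion_free M D" and met: "metric_connection M D"
    by blast+
  have vD: "vector_field M (D V W)" "vector_field M (?D0 V W)"
    if "vector_field M V" "vector_field M W" for V W
    using conjunct1[OF aff[unfolded affine_connection_def]]
      conjunct1[OF tangential_connection_levi_civita(1)[OF M, unfolded affine_connection_def]] that
    by blast+
  have inT: "D V W p \<in> tangent_space M p" "?D0 V W p \<in> tangent_space M p"
    if "vector_field M V" "vector_field M W" for V W
    using vector_fieldD(2)[OF vD(1)[OF that] p] vector_fieldD(2)[OF vD(2)[OF that] p] by simp_all
  note sub = subspace_tangent_space[OF M p]
  define s where "s V W Z = (D V W p - ?D0 V W p) \<bullet> Z p" for V W Z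
  have zero: "s V W Z = 0" if V: "V \<in> Collect (vector_field M)" "W \<in> Collect (vector_field M)"
    "Z \<in> Collect (vector_field M)" for V W Z
  proof (rule symmetric_skew_trilinear_zero[of "Collect (vector_field M)" s, OF _ _ that])
    fix V W Z assume "V \<in> Collect (vector_field M)" "W \<in> Collect (vector_field M)"
      "Z \<in> Collect (vector_field M)"
    then have v: "vector_field M V" "vector_field M W" "vector_field M Z" by auto
    have c: "smooth_map M (\<lambda>q. q \<bullet> c)" for c
      by (intro smooth_map_inner smooth_map_ident smooth_map_const)
    have e: "diff M (\<lambda>q. q \<bullet> c) p v = v \<bullet> c" if "v \<in> tangent_space M p" for c v
      using diff_inner_const[OF that, of "\<lambda>q. q"] diff_ident[OF that] by simp
    have "diff M (\<lambda>q. q \<bullet> c) p (D V W p - D W V p) = diff M (\<lambda>q. q \<bullet> c) p (?D0 V W p - ?D0 W V p)" for c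
      by (simp only: tor[unfolded torsion_free_def, rule_format, OF v(1,2) c p]
          tangential_connection_levi_civita(2)[OF M, unfolded torsion_free_def, rule_format, OF v(1,2) c p])
    then have "(D V W p - D W V p) \<bullet> c = (?D0 V W p - ?D0 W V p) \<bullet> c" for c
      using e inT v sub by (simp add: subspace_diff)
    from this[of "Z p"] show "s V W Z = s W V Z" unfolding s_def by (simp add: inner_diff_left)
    have "D V W p \<bullet> Z p + W p \<bullet> D V Z p = ?D0 V W p \<bullet> Z p + W p \<bullet> ?D0 V Z p"
      using met[unfolded metric_connection_def, rule_format, OF v p]
        tangential_connection_levi_civita(3)[OF M, unfolded metric_connection_def, rule_format, OF v p]
      by (simp only:)
    then show "s V W Z = - s V Z W"
      unfolding s_def inner_diff_left inner_commute[of "W p"] by linarith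
  qed
  have t: "D X Y p - ?D0 X Y p \<in> tangent_space M p" using inT[OF X Y] sub by (simp add: subspace_diff)
  \<comment> \<open>test the difference against the vector field that extends it\<close>
  have "(D X Y p - ?D0 X Y p) \<bullet> (D X Y p - ?D0 X Y p) = 0"
    using zero[of X Y "\<lambda>q. tproj M q (D X Y p - ?D0 X Y p)"] X Y vector_field_extension[OF M p t]
    by (simp add: s_def)
  then show ?thesis unfolding D_def by simp
qed

section \<open>Second fundamental form, mean curvature and tension\<close>

text \<open>Differentiate \<open>Y \<bullet> n = Y \<bullet> (tproj n)\<close> along \<open>M\<close>, where the projection of \<open>n\<close> vanishes at \<open>p\<close>.  The
  right hand side involves \<open>Y\<close> only through its value at \<open>p\<close>, which makes the normal component of the
  derivative tensorial.\<close>

lemma normal_component_derivative: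
  assumes M: "surface M" and Y: "vector_field M Y" and p: "p \<in> M" and u: "u \<in> tangent_space M p"
    and n: "\<And>t. t \<in> tangent_space M p \<Longrightarrow> n \<bullet> t = 0"
  shows "diff M Y p u \<bullet> n = Y p \<bullet> diff M (\<lambda>q. tproj M q n) p u"
proof -
  have N: "vector_field M (\<lambda>q. tproj M q n)" using M vector_field_tproj smooth_map_const by blast
  have "tproj M p n = 0"
    using n[OF tproj_in[OF M p, of n]] tproj_inner(2)[OF M p tproj_in[OF M p], of n n]
    by (simp add: inner_commute)
  have "diff M (\<lambda>q. Y q \<bullet> n) p = diff M (\<lambda>q. Y q \<bullet> tproj M q n) p"
    by (rule diff_cong[OF _ p]) (use tproj_inner(2)[OF M] vector_fieldD(2)[OF Y] in simp)
  then show ?thesis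
    using diff_inner_const[OF u vector_field_differentiable[OF M Y p], of n]
      diff_inner[OF u vector_field_differentiable[OF M Y p] vector_field_differentiable[OF M N p]]
      \<open>tproj M p n = 0\<close> by simp
qed

lemma normal_eqI:
  assumes "subspace V" "\<And>t. t \<in> V \<Longrightarrow> w \<bullet> t = 0" "\<And>t. t \<in> V \<Longrightarrow> w' \<bullet> t = 0"
    and "\<And>n. (\<And>t. t \<in> V \<Longrightarrow> n \<bullet> t = 0) \<Longrightarrow> w \<bullet> n = w' \<bullet> n"
  shows "w = (w'::'a::euclidean_space)"
proof -
  have "w \<bullet> (w - w') = w' \<bullet> (w - w')"
    by (rule assms(4)) (simp add: assms inner_diff_left)
  then have "(w - w') \<bullet> (w - w') = 0" by (simp add: inner_diff_left)
  then show ?thesis by simp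
qed

text \<open>The description defining the second fundamental form has a unique solution because any two fields
  with the same value at \<open>p\<close> have derivatives with the same normal component.\<close>

lemma second_fundamental_form_eq:
  assumes M: "surface M" and Y: "vector_field M Y" and p: "p \<in> M" and u: "u \<in> tangent_space M p"
  shows "second_fundamental_form M p u (Y p) = diff M Y p u - tproj M p (diff M Y p u)"
  unfolding second_fundamental_form_def
proof (rule the_equality)
  note sub = subspace_tangent_space[OF M p]
  have perp: "w \<in> (tangent_space M p)\<^sup>\<bottom> \<longleftrightarrow> (\<forall>t\<in>tangent_space M p. w \<bullet> t = 0)" for w
    by (auto simp: orthogonal_comp_def orthogonal_def inner_commute)
  let ?w = "diff M Y p u - tproj M p (diff M Y p u)"
  have wn: "?w \<bullet> t = 0" if "t \<in> tangent_space M p" for t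
    using that tproj_inner[OF M p] by (simp add: inner_diff_left)
  show "\<exists>Y'. vector_field M Y' \<and> Y' p = Y p \<and> ?w \<in> (tangent_space M p)\<^sup>\<bottom> \<and> diff M Y' p u - ?w \<in> tangent_space M p"
    using Y wn tproj_in[OF M p] by (intro exI[of _ Y]) (simp add: perp)
  fix w assume "\<exists>Y'. vector_field M Y' \<and> Y' p = Y p \<and> w \<in> (tangent_space M p)\<^sup>\<bottom> \<and> diff M Y' p u - w \<in> tangent_space M p"
  then obtain Y' where Y': "vector_field M Y'" "Y' p = Y p" and w: "\<And>t. t \<in> tangent_space M p \<Longrightarrow> w \<bullet> t = 0"
    and t: "diff M Y' p u - w \<in> tangent_space M p" unfolding perp by blast
  show "w = ?w"
  proof (rule normal_eqI[OF sub w wn])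
    fix n assume n: "\<And>t. t \<in> tangent_space M p \<Longrightarrow> n \<bullet> t = 0"
    have "w \<bullet> n = diff M Y' p u \<bullet> n" using n[OF t] by (simp add: inner_diff_right inner_commute)
    also have "\<dots> = diff M Y p u \<bullet> n"
      using normal_component_derivative[OF M _ p u n] Y Y' by metis
    also have "\<dots> = ?w \<bullet> n"
      using n[OF tproj_in[OF M p]] by (simp add: inner_diff_right inner_commute[of _ n])
    finally show "w \<bullet> n = ?w \<bullet> n" .
  qed
qed

lemma second_fundamental_form_tproj:
  assumes M: "surface M" and p: "p \<in> M" and u: "u \<in> tangent_space M p" and v: "v \<in> tangent_space M p"
  shows "second_fundamental_form M p u v =
    diff M (\<lambda>q. tproj M q v) p u - tproj M p (diff M (\<lambda>q. tproj M q v) p u)"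
  using second_fundamental_form_eq[OF M vector_field_extension(1)[OF M p v] p u]
    vector_field_extension(2)[OF M p v] by simp

lemma second_fundamental_form_normal:
  assumes M: "surface M" and p: "p \<in> M" and "u \<in> tangent_space M p" "v \<in> tangent_space M p"
    and "t \<in> tangent_space M p"
  shows "second_fundamental_form M p u v \<bullet> t = 0"
  unfolding second_fundamental_form_tproj[OF assms(1-4)]
  using assms(5) tproj_inner[OF M p] by (simp add: inner_diff_left)

lemma second_fundamental_form_symmetric:
  assumes M: "surface M" and p: "p \<in> M" and u: "u \<in> tangent_space M p" and v: "v \<in> tangent_space M p"
  shows "second_fundamental_form M p u v = second_fundamental_form M p v u"
proof -
  let ?U = "\<lambda>q. tproj M q u" and ?V = "\<lambda>q. tproj M q v"
  have "diff M ?V p u - diff M ?U p v \<in> tangent_space M p"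
    using lie_bracket_tangent[OF M vector_field_extension(1)[OF M p u] vector_field_extension(1)[OF M p v] p]
      vector_field_extension(2)[OF M p u] vector_field_extension(2)[OF M p v] by simp
  from tproj_tangent[OF M p this] show ?thesis
    unfolding second_fundamental_form_tproj[OF M p u v] second_fundamental_form_tproj[OF M p v u]
      tproj_linear[OF M p] by (simp add: algebra_simps)
qed

lemma second_fundamental_form_bilinear:
  assumes M: "surface M" and p: "p \<in> M"
  shows "bilinear_on (tangent_space M p) (second_fundamental_form M p)"
proof -
  let ?T = "tangent_space M p" and ?B = "second_fundamental_form M p"
  note sub = subspace_tangent_space[OF M p]
  have l: "linear (diff M (\<lambda>q. tproj M q v) p)" if "v \<in> ?T" for v
    using vector_field_extension[OF M p that] vector_field_differentiable[OF M _ p] linear_diff_map by blast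
  have 1: "?B (u + u') v = ?B u v + ?B u' v" "?B (c *\<^sub>R u) v = c *\<^sub>R ?B u v"
    if "u \<in> ?T" "u' \<in> ?T" "v \<in> ?T" for u u' v c
    using that sub l[OF that(3)]
    by (simp_all add: second_fundamental_form_tproj M p subspace_add subspace_mul linear_add linear_scale
        tproj_linear[OF M p] algebra_simps)
  show ?thesis
    unfolding bilinear_on_def
    using 1 sub second_fundamental_form_symmetric[OF M p] by (auto simp: subspace_add subspace_mul)
qed

text \<open>For the inclusion, the second fundamental form of the map is the derivative of a vector field minus
  its tangential part.\<close>

lemma nabla_d_id:
  assumes M: "surface M" and p: "p \<in> M" and u: "u \<in> tangent_space M p" and v: "v \<in> tangent_space M p"
  shows "nabla_d M id p u v = second_fundamental_form M p u v"
proof -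
  have val: "diff M (\<lambda>q. diff M id q (Y q)) p (X p) - diff M id p (levi_civita M X Y p) =
      second_fundamental_form M p u v"
    if X: "vector_field M X" "X p = u" and Y: "vector_field M Y" "Y p = v" for X Y
  proof -
    have "diff M (\<lambda>q. diff M id q (Y q)) p = diff M Y p"
      by (rule diff_cong[OF _ p]) (simp add: id_def diff_ident[OF vector_fieldD(2)[OF Y(1)]])
    moreover have "diff M id p (levi_civita M X Y p) = tproj M p (diff M Y p (X p))"
      unfolding levi_civita_eq_tangential_connection[OF M X(1) Y(1) p] tangential_connection_def
      using diff_ident[OF tproj_in[OF M p]] by (simp add: id_def)
    ultimately show ?thesis
      using second_fundamental_form_eq[OF M Y(1) p u] X Y by simp
  qed
  show ?thesis
    unfolding nabla_d_def
  proof (rule the_equality)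
    show "\<exists>X Y. vector_field M X \<and> vector_field M Y \<and> X p = u \<and> Y p = v \<and>
        second_fundamental_form M p u v =
        diff M (\<lambda>q. diff M id q (Y q)) p (X p) - diff M id p (levi_civita M X Y p)"
      using val vector_field_extension[OF M p u] vector_field_extension[OF M p v]
      by (intro exI[of _ "\<lambda>q. tproj M q u"] exI[of _ "\<lambda>q. tproj M q v"]) simp
    fix w assume "\<exists>X Y. vector_field M X \<and> vector_field M Y \<and> X p = u \<and> Y p = v \<and>
        w = diff M (\<lambda>q. diff M id q (Y q)) p (X p) - diff M id p (levi_civita M X Y p)"
    then obtain X Y where "vector_field M X" "vector_field M Y" "X p = u" "Y p = v"
      and w: "w = diff M (\<lambda>q. diff M id q (Y q)) p (X p) - diff M id p (levi_civita M X Y p)"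
      by (elim exE conjE)
    then show "w = second_fundamental_form M p u v" unfolding w by (intro val)
  qed
qed

lemma trace_on_cong:
  assumes "subspace V" "\<And>u v. u \<in> V \<Longrightarrow> v \<in> V \<Longrightarrow> b u v = b' u v"
  shows "trace_on V b = trace_on V b'"
proof -
  have "orthonormal_basis V (SOME E. orthonormal_basis V E)"
    using orthonormal_basis_exists[OF assms(1)] by (rule someI_ex)
  from orthonormal_basis_facts(2)[OF this] show ?thesis
    unfolding trace_on_def Let_def by (intro sum.cong refl assms(2)) auto
qed

lemma tension_id:
  assumes M: "surface M" and p: "p \<in> M"
  shows "tension M id p = 2 *\<^sub>R mean_curvature M p"
  unfolding tension_def mean_curvature_def
  using trace_on_cong[OF subspace_tangent_space[OF M p] nabla_d_id[OF M p]] by simp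

lemma trace_on_in:
  assumes "subspace V" "\<And>u. u \<in> V \<Longrightarrow> b u u \<bullet> n = 0"
  shows "trace_on V b \<bullet> n = 0"
proof -
  have "orthonormal_basis V (SOME E. orthonormal_basis V E)"
    using orthonormal_basis_exists[OF assms(1)] by (rule someI_ex)
  from orthonormal_basis_facts(2)[OF this] show ?thesis
    unfolding trace_on_def Let_def inner_sum_left by (intro sum.neutral ballI assms(2)) auto
qed

lemma mean_curvature_normal:
  assumes M: "surface M" and p: "p \<in> M" and t: "t \<in> tangent_space M p"
  shows "mean_curvature M p \<bullet> t = 0"
  unfolding mean_curvature_def
  using trace_on_in[OF subspace_tangent_space[OF M p], of "second_fundamental_form M p" t]
    second_fundamental_form_normal[OF M p _ _ t] by (simp only: inner_scaleR_left mult_zero_right)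

text \<open>With the trace taken over the standard basis, the mean curvature is composed of tangential
  projections and directional derivatives of the vector fields that extend the standard basis.\<close>

lemma smooth_map_mean_curvature:
  assumes M: "surface M"
  shows "smooth_map M (mean_curvature M)"
proof -
  let ?D = "\<lambda>i q. diff M (\<lambda>r. tproj M r i) q (tproj M q i)"
  have v: "vector_field M (\<lambda>r. tproj M r i)" for i using M vector_field_tproj smooth_map_const by blast
  have "smooth_map M (?D i)" for i
    by (rule smooth_map_directional_derivative[OF M vector_fieldD(1)[OF v] v])
  then have "smooth_map M (\<lambda>q. (1/2) *\<^sub>R (\<Sum>i\<in>Basis. ?D i q - tproj M q (?D i q)))"
    by (intro smooth_map_scaleR smooth_map_const smooth_map_sum smooth_map_diff
        vector_fieldD(1)[OF vector_field_tproj[OF M]])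
  then show ?thesis
  proof (rule smooth_map_cong)
    fix q assume q: "q \<in> M"
    have "second_fundamental_form M q (tproj M q i) (tproj M q i) = ?D i q - tproj M q (?D i q)" for i
      by (rule second_fundamental_form_eq[OF M v q tproj_in[OF M q]])
    then show "(1/2) *\<^sub>R (\<Sum>i\<in>Basis. ?D i q - tproj M q (?D i q)) = mean_curvature M q"
      unfolding mean_curvature_def
        trace_on_eq[OF subspace_tangent_space[OF M q] second_fundamental_form_bilinear[OF M q]] by simp
  qed
qed

lemma bilinear_on_inner_const: "bilinear_on V b \<Longrightarrow> bilinear_on V (\<lambda>u v. b u v \<bullet> c)"
  unfolding bilinear_on_def by (simp add: inner_add_left)

lemma trace_inner_const:
  assumes "subspace V" "bilinear_on V b"
  shows "trace_on V (\<lambda>u v. b u v \<bullet> c) = trace_on V b \<bullet> c"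
  unfolding trace_on_eq[OF assms] trace_on_eq[OF assms(1) bilinear_on_inner_const[OF assms(2)]]
  by (simp add: inner_sum_left)

text \<open>The Weingarten equation, obtained by differentiating the inner product of \<open>N\<close> with a vector field
  that extends \<open>u\<close>, which is zero.\<close>

lemma inner_derivative_of_normal_field:
  assumes M: "surface M" and p: "p \<in> M" and u: "u \<in> tangent_space M p" and v: "v \<in> tangent_space M p"
    and N: "N differentiable (at p within M)"
    and normal: "\<And>q t. q \<in> M \<Longrightarrow> t \<in> tangent_space M q \<Longrightarrow> N q \<bullet> t = 0"
  shows "u \<bullet> diff M N p v = - (second_fundamental_form M p v u \<bullet> N p)"
proof -
  let ?U = "\<lambda>q. tproj M q u"
  note U = vector_field_extension[OF M p u]
  have "diff M (\<lambda>q. ?U q \<bullet> N q) p = diff M (\<lambda>q. 0) p"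
    by (rule diff_cong[OF _ p]) (simp add: inner_commute[of _ "N _"] normal[OF _ tproj_in[OF M]])
  then have "diff M (\<lambda>q. ?U q \<bullet> N q) p v = 0"
    using diff_eq[OF has_derivative_const v] by metis
  then have "diff M ?U p v \<bullet> N p + u \<bullet> diff M N p v = 0"
    using diff_inner[OF v vector_field_differentiable[OF M U(1) p] N] U(2) by simp
  moreover have "second_fundamental_form M p v u \<bullet> N p = diff M ?U p v \<bullet> N p"
    unfolding second_fundamental_form_tproj[OF M p v u]
    by (simp add: inner_diff_right inner_commute[of _ "N p"] normal[OF p tproj_in[OF M p]])
  ultimately show ?thesis by simp
qed

text \<open>With \<open>\<tau> = 2 H\<close>, the Weingarten equation turns each term \<open>u \<bullet> d\<tau>(v)\<close> into \<open>- 2 H \<bullet> B(u, v)\<close>, whose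
  trace is \<open>- 4 |H|\<^sup>2\<close>; together with \<open>|\<tau>|\<^sup>2 / 2 = 2 |H|\<^sup>2\<close> this gives the coefficient of the metric.\<close>

lemma biharmonic_stress_energy_id:
  assumes M: "surface M" and p: "p \<in> M" and u: "u \<in> tangent_space M p" and v: "v \<in> tangent_space M p"
  shows "biharmonic_stress_energy M id p u v =
    - 2 * (norm (mean_curvature M p))\<^sup>2 * (u \<bullet> v) +
    4 * (mean_curvature M p \<bullet> second_fundamental_form M p u v)"
proof -
  let ?H = "mean_curvature M" and ?B = "second_fundamental_form M p" and ?T = "tangent_space M p"
  let ?\<tau> = "tension M id"
  have Hd: "?H differentiable (at p within M)"
    using smooth_map_differentiable[OF M smooth_map_mean_curvature[OF M] p] .
  have d\<tau>: "w \<bullet> diff M ?\<tau> p z = - 2 * (?B w z \<bullet> ?H p)" if w: "w \<in> ?T" and z: "z \<in> ?T" for w z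
  proof -
    have "diff M ?\<tau> p = diff M (\<lambda>q. 2 *\<^sub>R ?H q) p"
      by (rule diff_cong[OF _ p]) (rule tension_id[OF M])
    then have "diff M ?\<tau> p z = 2 *\<^sub>R diff M ?H p z"
      using diff_eq[OF has_derivative_scaleR_right[OF differentiable_has_diff[OF Hd]] z] by simp
    then show ?thesis
      using inner_derivative_of_normal_field[OF M p w z Hd mean_curvature_normal[OF M]]
        second_fundamental_form_symmetric[OF M p w z] by simp
  qed
  have did: "diff M id p w = w" if "w \<in> ?T" for w using diff_ident[OF that] by (simp add: id_def)
  note sub = subspace_tangent_space[OF M p] and bil = second_fundamental_form_bilinear[OF M p]
  have "trace_on ?T (\<lambda>e e'. diff M id p e \<bullet> diff M ?\<tau> p e') = trace_on ?T (\<lambda>e e'. ?B e e' \<bullet> (-2 *\<^sub>R ?H p))"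
    by (rule trace_on_cong[OF sub]) (simp add: did d\<tau>)
  also have "\<dots> = (2 *\<^sub>R ?H p) \<bullet> (-2 *\<^sub>R ?H p)"
    unfolding trace_inner_const[OF sub bil] mean_curvature_def by simp
  finally have tr: "trace_on ?T (\<lambda>e e'. diff M id p e \<bullet> diff M ?\<tau> p e') = - 4 * (norm (?H p))\<^sup>2"
    by (simp add: power2_norm_eq_inner)
  show ?thesis
    unfolding biharmonic_stress_energy_def Let_def tr
    using did d\<tau> u v tension_id[OF M p] second_fundamental_form_symmetric[OF M p u v]
    by (simp add: power_mult_distrib inner_commute algebra_simps)
qed

section \<open>The Gauss map and the canonical metric\<close>

text \<open>Up to the factor 2, the inner product of matrices is the usual one of bivectors.\<close>

lemma inner_wedge: "wedge a b \<bullet> wedge c d = 2 * ((a \<bullet> c) * (b \<bullet> d) - (a \<bullet> d) * (b \<bullet> c))"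
proof -
  have prod: "(x \<bullet> y) * (z \<bullet> w) = (\<Sum>i\<in>UNIV. \<Sum>j\<in>UNIV. (x $ i * y $ i) * (z $ j * w $ j))"
    for x y z w :: "real^'n"
    by (simp add: inner_vec_def sum_product)
  have 1: "(x \<bullet> y) * (z \<bullet> w) = (\<Sum>i\<in>UNIV. \<Sum>j\<in>UNIV. (x $ j * y $ j) * (z $ i * w $ i))"
    for x y z w :: "real^'n"
    unfolding prod by (rule sum.swap)
  have "wedge a b \<bullet> wedge c d = (\<Sum>i\<in>UNIV. \<Sum>j\<in>UNIV.
     (a $ i * c $ i) * (b $ j * d $ j) - (a $ i * d $ i) * (b $ j * c $ j)
     - (a $ j * d $ j) * (b $ i * c $ i) + (a $ j * c $ j) * (b $ i * d $ i))"
    unfolding wedge_def inner_vec_def by (simp add: algebra_simps)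
  also have "\<dots> = (a \<bullet> c) * (b \<bullet> d) - (a \<bullet> d) * (b \<bullet> c) - (a \<bullet> d) * (b \<bullet> c) + (a \<bullet> c) * (b \<bullet> d)"
    by (simp only: sum.distrib sum_subtractf prod[symmetric] 1[symmetric])
  finally show ?thesis by simp
qed

lemma linear_wedge: "linear (\<lambda>a. wedge a b)" "linear (\<lambda>b. wedge a b)"
  by (rule linearI; simp add: wedge_def vec_eq_iff algebra_simps)+

lemma bounded_bilinear_wedge: "bounded_bilinear wedge"
  by (simp add: bilinear_conv_bounded_bilinear[symmetric] bilinear_def linear_wedge)

lemma wedge_change_of_basis:
  "wedge (a *\<^sub>R x + b *\<^sub>R y) (c *\<^sub>R x + d *\<^sub>R y) = (a * d - b * c) *\<^sub>R wedge x y"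
  by (simp add: wedge_def vec_eq_iff algebra_simps)

lemma inner_wedge_frame:
  assumes "norm x = 1" "norm y = 1" "orthogonal x y"
    and "A \<bullet> x = 0" "A \<bullet> y = 0" "C \<bullet> x = 0" "C \<bullet> y = 0"
    and "A' \<bullet> x = 0" "A' \<bullet> y = 0" "C' \<bullet> x = 0" "C' \<bullet> y = 0"
  shows "(wedge A y + wedge x C) \<bullet> (wedge A' y + wedge x C') = 2 * (A \<bullet> A' + C \<bullet> C')"
  using assms
  by (simp add: inner_add_left inner_add_right inner_wedge norm_eq_1 orthogonal_def inner_commute)

text \<open>Whatever representation of the two tangent vectors is used, the number it yields is half of their
  inner product as matrices.  Hence the canonical metric is well defined, and can be evaluated on
  unnormalized normal vectors.\<close>

lemma grassmann_metric_eq: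
  fixes x y :: "real^'n"
  assumes xy: "norm x = 1" "norm y = 1" "orthogonal x y"
    and A: "A \<bullet> x = 0" "A \<bullet> y = 0" and C: "C \<bullet> x = 0" "C \<bullet> y = 0"
    and A': "A' \<bullet> x = 0" "A' \<bullet> y = 0" and C': "C' \<bullet> x = 0" "C' \<bullet> y = 0"
  shows "grassmann_metric (wedge x y) (wedge A y + wedge x C) (wedge A' y + wedge x C') =
    A \<bullet> A' + C \<bullet> C'"
proof -
  let ?\<xi> = "wedge A y + wedge x C" and ?\<eta> = "wedge A' y + wedge x C'"
  have in_perp: "a \<in> {z, w}\<^sup>\<bottom> \<longleftrightarrow> a \<bullet> z = 0 \<and> a \<bullet> w = 0" for a z w :: "real^'n"
    by (auto simp: orthogonal_comp_def orthogonal_def inner_commute)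
  have split: "(\<Sum>a\<in>E. c a *\<^sub>R wedge a w + d a *\<^sub>R wedge z a) =
      wedge (\<Sum>a\<in>E. c a *\<^sub>R a) w + wedge z (\<Sum>a\<in>E. d a *\<^sub>R a)" for E c d and z w :: "real^'n"
    by (simp add: sum.distrib linear_sum[OF linear_wedge(1)] linear_sum[OF linear_wedge(2)]
        linear_scale[OF linear_wedge(1)] linear_scale[OF linear_wedge(2)])
  have sums: "(\<Sum>a\<in>E. c a *\<^sub>R a) \<bullet> (\<Sum>a\<in>E. d a *\<^sub>R a) = (\<Sum>a\<in>E. c a * d a)"
    if E: "orthonormal_basis ({z, w}\<^sup>\<bottom>) E" for E c d and z w :: "real^'n"
  proof -
    note facts = orthonormal_basis_facts[OF E]
    have "(\<Sum>a\<in>E. c a *\<^sub>R a) \<bullet> (\<Sum>a\<in>E. d a *\<^sub>R a) = (\<Sum>a\<in>E. \<Sum>e\<in>E. if a = e then c a * d a else 0)"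
      unfolding inner_sum_left inner_sum_right by (intro sum.cong refl) (simp add: facts(4))
    then show ?thesis using facts(1) by simp
  qed
  have perp: "(\<Sum>a\<in>E. c a *\<^sub>R a) \<in> {z, w}\<^sup>\<bottom>" if E: "orthonormal_basis ({z, w}\<^sup>\<bottom>) E" for E c and z w :: "real^'n"
    using orthonormal_basis_facts[OF E] by (auto intro!: subspace_sum subspace_mul)
  have unique: "r = ?\<xi> \<bullet> ?\<eta> / 2"
    if z: "norm z = 1" "norm w = 1" "orthogonal z w" and E: "orthonormal_basis ({z, w}\<^sup>\<bottom>) E"
      and \<xi>: "?\<xi> = (\<Sum>a\<in>E. c a *\<^sub>R wedge a w + d a *\<^sub>R wedge z a)"
      and \<eta>: "?\<eta> = (\<Sum>a\<in>E. c' a *\<^sub>R wedge a w + d' a *\<^sub>R wedge z a)"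
      and r: "r = (\<Sum>a\<in>E. c a * c' a + d a * d' a)" for r z w E c d c' d'
    using inner_wedge_frame[OF z, of "\<Sum>a\<in>E. c a *\<^sub>R a" "\<Sum>a\<in>E. d a *\<^sub>R a"
        "\<Sum>a\<in>E. c' a *\<^sub>R a" "\<Sum>a\<in>E. d' a *\<^sub>R a"] perp[OF E]
    unfolding \<xi> \<eta> split in_perp sums[OF E] r by (simp add: sum.distrib)
  have "grassmann_metric (wedge x y) ?\<xi> ?\<eta> = ?\<xi> \<bullet> ?\<eta> / 2"
    unfolding grassmann_metric_def
  proof (rule the_equality)
    have "subspace ({x, y}\<^sup>\<bottom>)" by (rule subspace_orthogonal_comp)
    then obtain E where E: "orthonormal_basis ({x, y}\<^sup>\<bottom>) E" using orthonormal_basis_exists by blast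
    have expand: "(\<Sum>a\<in>E. (z \<bullet> a) *\<^sub>R a) = z" if "z \<bullet> x = 0" "z \<bullet> y = 0" for z
      using proj_orthonormal_basis[OF E, of z] proj_id[OF subspace_orthogonal_comp, of z "{x, y}"] that
      by (simp add: in_perp)
    have \<xi>: "?\<xi> = (\<Sum>a\<in>E. (A \<bullet> a) *\<^sub>R wedge a y + (C \<bullet> a) *\<^sub>R wedge x a)"
      and \<eta>: "?\<eta> = (\<Sum>a\<in>E. (A' \<bullet> a) *\<^sub>R wedge a y + (C' \<bullet> a) *\<^sub>R wedge x a)"
      unfolding split using A C A' C' by (simp_all add: expand)
    show "\<exists>x' y' E c d c' d'. norm x' = 1 \<and> norm y' = 1 \<and> orthogonal x' y' \<and> wedge x y = wedge x' y' \<and>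
        orthonormal_basis ({x', y'}\<^sup>\<bottom>) E \<and>
        ?\<xi> = (\<Sum>a\<in>E. c a *\<^sub>R wedge a y' + d a *\<^sub>R wedge x' a) \<and>
        ?\<eta> = (\<Sum>a\<in>E. c' a *\<^sub>R wedge a y' + d' a *\<^sub>R wedge x' a) \<and>
        ?\<xi> \<bullet> ?\<eta> / 2 = (\<Sum>a\<in>E. c a * c' a + d a * d' a)"
      by (intro exI[of _ x] exI[of _ y] exI[of _ E] exI[of _ "(\<bullet>) A"] exI[of _ "(\<bullet>) C"]
          exI[of _ "(\<bullet>) A'"] exI[of _ "(\<bullet>) C'"] conjI)
        (rule xy refl E \<xi> \<eta> unique[OF xy E \<xi> \<eta> refl, symmetric])+
    fix r assume "\<exists>x' y' E c d c' d'. norm x' = 1 \<and> norm y' = 1 \<and> orthogonal x' y' \<and> wedge x y = wedge x' y' \<and>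
        orthonormal_basis ({x', y'}\<^sup>\<bottom>) E \<and>
        ?\<xi> = (\<Sum>a\<in>E. c a *\<^sub>R wedge a y' + d a *\<^sub>R wedge x' a) \<and>
        ?\<eta> = (\<Sum>a\<in>E. c' a *\<^sub>R wedge a y' + d' a *\<^sub>R wedge x' a) \<and>
        r = (\<Sum>a\<in>E. c a * c' a + d a * d' a)"
    then show "r = ?\<xi> \<bullet> ?\<eta> / 2" by (elim exE conjE) (rule unique)
  qed
  then show ?thesis using inner_wedge_frame[OF assms] by simp
qed

text \<open>The positively oriented orthonormal bases are related to the coordinate frame by matrices of
  positive determinant, and comparing norms shows that this determinant is the inverse of the root of
  the Gram determinant.  The Gram-Schmidt process provides such a basis.\<close>

lemma gauss_map_chart:
  fixes x :: "real^2 \<Rightarrow> real^'n"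
  assumes par: "parametrization M U x" and u: "u \<in> U"
    and Or: "Or (x u) = {(a *\<^sub>R pd1 x u + b *\<^sub>R pd2 x u, c *\<^sub>R pd1 x u + d *\<^sub>R pd2 x u) | a b c d. a * d - b * c > 0}"
  defines "\<Delta> \<equiv> (pd1 x u \<bullet> pd1 x u) * (pd2 x u \<bullet> pd2 x u) - (pd1 x u \<bullet> pd2 x u)\<^sup>2"
  shows "gauss_map Or (x u) = (1 / sqrt \<Delta>) *\<^sub>R wedge (pd1 x u) (pd2 x u)"
    and "\<exists>e1 e2. norm e1 = 1 \<and> norm e2 = 1 \<and> orthogonal e1 e2 \<and>
       tangent_space M (x u) = {a *\<^sub>R e1 + b *\<^sub>R e2 | a b. True} \<and> gauss_map Or (x u) = wedge e1 e2"
proof -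
  let ?x1 = "pd1 x u" and ?x2 = "pd2 x u"
  define E F G where "E = ?x1 \<bullet> ?x1" and "F = ?x1 \<bullet> ?x2" and "G = ?x2 \<bullet> ?x2"
  have \<Delta>: "\<Delta> = E * G - F\<^sup>2" unfolding \<Delta>_def E_def F_def G_def ..
  have "\<Delta> > 0" using gram_determinant_pos[OF par u] by (simp add: \<Delta>_def)
  have "E \<noteq> 0"
  proof
    assume "E = 0"
    then have "\<Delta> \<le> 0" unfolding \<Delta> by simp
    then show False using \<open>\<Delta> > 0\<close> by simp
  qed
  then have "E > 0" using inner_ge_zero[of ?x1] by (simp add: E_def)
  have ip: "(a *\<^sub>R ?x1 + b *\<^sub>R ?x2) \<bullet> (c *\<^sub>R ?x1 + d *\<^sub>R ?x2) =
      a * c * E + (a * d + b * c) * F + b * d * G" for a b c d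
    by (simp add: E_def F_def G_def inner_add_left inner_add_right inner_commute[of ?x2 ?x1]
        algebra_simps)
  define e1 where "e1 = (1 / sqrt E) *\<^sub>R ?x1 + 0 *\<^sub>R ?x2"
  define e2 where "e2 = (- F / (sqrt E * sqrt \<Delta>)) *\<^sub>R ?x1 + (sqrt E / sqrt \<Delta>) *\<^sub>R ?x2"
  have EE: "sqrt E * sqrt E = E" "sqrt \<Delta> * sqrt \<Delta> = \<Delta>" "sqrt E \<noteq> 0" "sqrt \<Delta> \<noteq> 0"
    using \<open>E > 0\<close> \<open>\<Delta> > 0\<close> by auto
  have n1: "norm e1 = 1"
    using \<open>E > 0\<close> unfolding norm_eq_1 e1_def ip by simp
  have o12: "orthogonal e1 e2"
    using \<open>E > 0\<close> \<open>\<Delta> > 0\<close> unfolding orthogonal_def e1_def e2_def ip by (simp add: field_simps)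
  have "e2 \<bullet> e2 = (E * G - F * F) / \<Delta>"
    using \<open>E > 0\<close> \<open>\<Delta> > 0\<close> unfolding e2_def ip by (simp add: field_simps)
  also have "\<dots> = 1" using \<open>\<Delta> > 0\<close> \<Delta> by (simp add: power2_eq_square)
  finally have n2: "norm e2 = 1" by (simp add: norm_eq_1)
  have "(1 / sqrt E) * (sqrt E / sqrt \<Delta>) - 0 * (- F / (sqrt E * sqrt \<Delta>)) > 0"
    using \<open>E > 0\<close> \<open>\<Delta> > 0\<close> by simp
  then have mem: "(e1, e2) \<in> Or (x u)" unfolding Or e1_def e2_def by blast
  have uniq: "wedge f1 f2 = (1 / sqrt \<Delta>) *\<^sub>R wedge ?x1 ?x2"
    if f: "(f1, f2) \<in> Or (x u)" and "norm f1 = 1" "norm f2 = 1" "orthogonal f1 f2" for f1 f2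
  proof -
    obtain a b c d where f1: "f1 = a *\<^sub>R ?x1 + b *\<^sub>R ?x2" and f2: "f2 = c *\<^sub>R ?x1 + d *\<^sub>R ?x2"
      and k: "a * d - b * c > 0" using f unfolding Or by blast
    let ?k = "a * d - b * c"
    have w: "wedge f1 f2 = ?k *\<^sub>R wedge ?x1 ?x2" unfolding f1 f2 by (rule wedge_change_of_basis)
    have "wedge f1 f2 \<bullet> wedge f1 f2 = 2"
      using that(2-4) by (simp add: inner_wedge norm_eq_1 orthogonal_def)
    moreover have "wedge f1 f2 \<bullet> wedge f1 f2 = ?k\<^sup>2 * (2 * \<Delta>)"
      unfolding w by (simp add: inner_wedge \<Delta>_def power2_eq_square inner_commute)
    ultimately have "?k\<^sup>2 * \<Delta> = 1" by simp
    then have "sqrt (?k\<^sup>2 * \<Delta>) = 1" by simp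
    then have "?k * sqrt \<Delta> = 1" using k by (simp add: real_sqrt_mult)
    then have "?k = 1 / sqrt \<Delta>" using EE by (simp add: field_simps)
    then show ?thesis using w by simp
  qed
  show 1: "gauss_map Or (x u) = (1 / sqrt \<Delta>) *\<^sub>R wedge ?x1 ?x2"
    unfolding gauss_map_def
  proof (rule the_equality)
    show "\<exists>f1 f2. (f1, f2) \<in> Or (x u) \<and> norm f1 = 1 \<and> norm f2 = 1 \<and> orthogonal f1 f2 \<and>
        (1 / sqrt \<Delta>) *\<^sub>R wedge ?x1 ?x2 = wedge f1 f2"
      using mem n1 n2 o12 uniq[OF mem n1 n2 o12] by (intro exI[of _ e1] exI[of _ e2]) simp
  qed (elim exE conjE, simp add: uniq)
  have T: "tangent_space M (x u) = {a *\<^sub>R e1 + b *\<^sub>R e2 | a b. True}"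
  proof (rule subset_antisym)
    have x1: "?x1 = sqrt E *\<^sub>R e1" using EE by (simp add: e1_def)
    have x2: "?x2 = (F / sqrt E) *\<^sub>R e1 + (sqrt \<Delta> / sqrt E) *\<^sub>R e2"
      using EE by (simp add: e1_def e2_def scaleR_add_right field_simps)
    have "a *\<^sub>R ?x1 + b *\<^sub>R ?x2 =
       (a * sqrt E + b * (F / sqrt E)) *\<^sub>R e1 + (b * (sqrt \<Delta> / sqrt E)) *\<^sub>R e2" for a b
      by (subst x1, subst x2) (simp add: algebra_simps)
    then show "tangent_space M (x u) \<subseteq> {a *\<^sub>R e1 + b *\<^sub>R e2 | a b. True}"
      unfolding tangent_space_chart_coordinates[OF par u] by blast
    have "a *\<^sub>R (b *\<^sub>R ?x1 + c *\<^sub>R ?x2) + a' *\<^sub>R (b' *\<^sub>R ?x1 + c' *\<^sub>R ?x2) =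
       (a * b + a' * b') *\<^sub>R ?x1 + (a * c + a' * c') *\<^sub>R ?x2" for a b c a' b' c'
      by (simp add: algebra_simps)
    then show "{a *\<^sub>R e1 + b *\<^sub>R e2 | a b. True} \<subseteq> tangent_space M (x u)"
      unfolding tangent_space_chart_coordinates[OF par u] e1_def e2_def by blast
  qed
  show "\<exists>e1 e2. norm e1 = 1 \<and> norm e2 = 1 \<and> orthogonal e1 e2 \<and>
       tangent_space M (x u) = {a *\<^sub>R e1 + b *\<^sub>R e2 | a b. True} \<and> gauss_map Or (x u) = wedge e1 e2"
    by (intro exI[of _ e1] exI[of _ e2] conjI n1 n2 o12 T) (simp only: 1 uniq[OF mem n1 n2 o12])
qed

text \<open>Differentiability is read off from the chart formula, the root of the Gram determinant being
  differentiable where the determinant is positive.\<close>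

lemma gauss_map_differentiable:
  fixes M :: "(real^'n) set"
  assumes Or: "orientation M Or" and p: "p \<in> M"
  shows "gauss_map Or differentiable (at p within M)"
    and "\<exists>e1 e2. norm e1 = 1 \<and> norm e2 = 1 \<and> orthogonal e1 e2 \<and>
       tangent_space M p = {a *\<^sub>R e1 + b *\<^sub>R e2 | a b. True} \<and> gauss_map Or p = wedge e1 e2"
proof -
  obtain U x where par: "parametrization M U x" and px: "p \<in> x ` U"
    and chart: "\<And>u. u \<in> U \<Longrightarrow> Or (x u) =
       {(a *\<^sub>R pd1 x u + b *\<^sub>R pd2 x u, c *\<^sub>R pd1 x u + d *\<^sub>R pd2 x u) | a b c d. a * d - b * c > 0}"
    using bspec[OF Or[unfolded orientation_def Let_def] p]
    by (elim exE conjE) (rule that, assumption, assumption, erule (1) bspec)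
  obtain u where u: "u \<in> U" "p = x u" using px by blast
  note facts = parametrization_facts[OF par]
  show "\<exists>e1 e2. norm e1 = 1 \<and> norm e2 = 1 \<and> orthogonal e1 e2 \<and>
       tangent_space M p = {a *\<^sub>R e1 + b *\<^sub>R e2 | a b. True} \<and> gauss_map Or p = wedge e1 e2"
    unfolding u(2) by (rule gauss_map_chart(2)[where Or = Or and x = x and u = u, OF par u(1) chart[OF u(1)]])
  define \<Delta> where "\<Delta> w = (pd1 x w \<bullet> pd1 x w) * (pd2 x w \<bullet> pd2 x w) - (pd1 x w \<bullet> pd2 x w) * (pd1 x w \<bullet> pd2 x w)" for w
  have \<Delta>: "\<Delta> u > 0" using gram_determinant_pos[OF par u(1)] by (simp add: \<Delta>_def power2_eq_square)
  have s: "smooth_on U \<Delta>" "smooth_on U (pd1 x)" "smooth_on U (pd2 x)"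
    unfolding \<Delta>_def[abs_def] by (intro smooth_intros facts)+
  note D = s[THEN smooth_on_has_derivative, OF u(1)]
  have 1: "(\<lambda>w. 1 / sqrt (\<Delta> w)) differentiable at u"
    using \<Delta> differentiableI[OF has_derivative_real_sqrt[OF \<Delta> D(1)]]
    by (intro differentiable_divide differentiable_const) simp_all
  have 2: "(\<lambda>w. wedge (pd1 x w) (pd2 x w)) differentiable at u"
    by (rule differentiableI[OF bounded_bilinear.FDERIV[OF bounded_bilinear_wedge D(2,3)]])
  have "(\<lambda>w. (1 / sqrt (\<Delta> w)) *\<^sub>R wedge (pd1 x w) (pd2 x w)) differentiable at u"
    by (rule differentiable_scaleR[OF 1 2])
  then obtain D' where "((\<lambda>w. (1 / sqrt (\<Delta> w)) *\<^sub>R wedge (pd1 x w) (pd2 x w)) has_derivative D') (at u)"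
    unfolding differentiable_def by blast
  moreover have "gauss_map Or (x w) = (1 / sqrt (\<Delta> w)) *\<^sub>R wedge (pd1 x w) (pd2 x w)" if "w \<in> U" for w
    using gauss_map_chart(1)[where Or = Or and x = x and u = w, OF par that chart[OF that]]
    by (simp add: \<Delta>_def power2_eq_square)
  ultimately have "((gauss_map Or \<circ> x) has_derivative D') (at u)"
    using facts(1) u(1) by (auto intro: has_derivative_transform_within_open)
  from has_derivative_within_surface[OF par u(1) this]
  show "gauss_map Or differentiable (at p within M)"
    unfolding differentiable_def u(2) by blast
qed

text \<open>Extend \<open>e1\<close> and \<open>e2\<close> to vector fields \<open>E1\<close> and \<open>E2\<close>.  Their exterior product \<open>W\<close> stays in the line
  spanned by \<open>G\<close>, and agrees with \<open>G\<close> at \<open>p\<close>, so the derivatives of \<open>W\<close> and \<open>G\<close> at \<open>p\<close> differ by a multiple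
  of \<open>G\<close>.  The tangential parts of the derivatives of the \<open>Ei\<close> also contribute only multiples of \<open>G\<close>
  to the derivative of \<open>W\<close>, and the normal parts give the stated bivector.  All multiples of \<open>G\<close>
  cancel because \<open>G\<close>, having constant norm, is orthogonal to its derivative.\<close>

lemma diff_gauss_map:
  fixes M :: "(real^'n) set"
  assumes M: "surface M" and Or: "orientation M Or" and p: "p \<in> M" and u: "u \<in> tangent_space M p"
    and e: "norm e1 = 1" "norm e2 = 1" "orthogonal e1 e2"
    and T: "tangent_space M p = {a *\<^sub>R e1 + b *\<^sub>R e2 | a b. True}"
    and G: "gauss_map Or p = wedge e1 e2"
  shows "diff M (gauss_map Or) p u =
    wedge (second_fundamental_form M p u e1) e2 + wedge e1 (second_fundamental_form M p u e2)"
proof -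
  let ?G = "gauss_map Or" and ?B = "second_fundamental_form M p"
  have eT: "e1 \<in> tangent_space M p" "e2 \<in> tangent_space M p"
  proof -
    have "e1 = 1 *\<^sub>R e1 + 0 *\<^sub>R e2" "e2 = 0 *\<^sub>R e1 + 1 *\<^sub>R e2" by simp_all
    then show "e1 \<in> tangent_space M p" "e2 \<in> tangent_space M p" unfolding T by blast+
  qed
  have ee: "e1 \<bullet> e1 = 1" "e2 \<bullet> e2 = 1" "e1 \<bullet> e2 = 0" "e2 \<bullet> e1 = 0"
    using e by (simp_all add: norm_eq_1 orthogonal_def inner_commute)
  define E1 where "E1 q = tproj M q e1" for q
  define E2 where "E2 q = tproj M q e2" for q
  define W where "W q = wedge (E1 q) (E2 q)" for q
  \<comment> \<open>\<open>G\<close> has norm \<open>\<surd>2\<close> as a matrix, hence the factor \<open>1/2\<close> in the coordinate of \<open>W\<close> with respect to \<open>G\<close>.\<close>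
  define s where "s q = W q \<bullet> ((1/2) *\<^sub>R ?G q)" for q
  have E: "E1 p = e1" "E2 p = e2"
    unfolding E1_def E2_def using vector_field_extension(2)[OF M p] eT by auto
  have ED: "E1 differentiable (at p within M)" "E2 differentiable (at p within M)"
    unfolding E1_def[abs_def] E2_def[abs_def]
    using vector_field_extension(1)[OF M p] eT vector_field_differentiable[OF M _ p] by auto
  have GD: "?G differentiable (at p within M)" by (rule gauss_map_differentiable(1)[OF Or p])
  have G2: "?G q \<bullet> ?G q = 2" and WG: "W q = s q *\<^sub>R ?G q" if q: "q \<in> M" for q
  proof -
    obtain f1 f2 where f: "norm f1 = 1" "norm f2 = 1" "orthogonal f1 f2"
      and Tq: "tangent_space M q = {a *\<^sub>R f1 + b *\<^sub>R f2 | a b. True}" and Gq: "?G q = wedge f1 f2"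
      using gauss_map_differentiable(2)[OF Or q] by (elim exE conjE)
    show 2: "?G q \<bullet> ?G q = 2"
      unfolding Gq using f by (simp add: inner_wedge norm_eq_1 orthogonal_def)
    have "E1 q \<in> tangent_space M q" "E2 q \<in> tangent_space M q"
      unfolding E1_def E2_def by (rule tproj_in[OF M q])+
    then obtain a b c d where "E1 q = a *\<^sub>R f1 + b *\<^sub>R f2" "E2 q = c *\<^sub>R f1 + d *\<^sub>R f2"
      unfolding Tq by blast
    then have "W q = (a * d - b * c) *\<^sub>R ?G q"
      unfolding W_def Gq by (simp only: wedge_change_of_basis)
    then show "W q = s q *\<^sub>R ?G q" unfolding s_def using 2 by simp
  qed
  have "(W has_derivative (\<lambda>v. wedge (E1 p) (diff M E2 p v) + wedge (diff M E1 p v) (E2 p))) (at p within M)"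
    unfolding W_def[abs_def]
    by (rule bounded_bilinear.FDERIV[OF bounded_bilinear_wedge differentiable_has_diff[OF ED(1)]
          differentiable_has_diff[OF ED(2)]])
  note WD = differentiableI[OF this] diff_eq[OF this u, unfolded E]
  have sD: "s differentiable (at p within M)"
    unfolding s_def[abs_def]
    using differentiableI[OF has_derivative_inner[OF differentiable_has_diff[OF WD(1)]
          has_derivative_scaleR_right[OF differentiable_has_diff[OF GD], of "1/2"]]] .
  have sp: "s p = 1"
    unfolding s_def W_def E G by (simp add: inner_wedge ee)
  have "diff M W p = diff M (\<lambda>q. s q *\<^sub>R ?G q) p"
    by (rule diff_cong[OF WG p])
  then have 1: "diff M W p u = diff M s p u *\<^sub>R wedge e1 e2 + diff M ?G p u"
    using diff_scaleR[OF u sD GD] sp G by simp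
  have "diff M (\<lambda>q. ?G q \<bullet> ?G q) p = diff M (\<lambda>q. 2) p"
    by (rule diff_cong[OF G2 p])
  then have "diff M (\<lambda>q. ?G q \<bullet> ?G q) p u = 0"
    using diff_eq[OF has_derivative_const u, of 2] by simp
  then have GdG: "wedge e1 e2 \<bullet> diff M ?G p u = 0"
    using diff_inner[OF u GD GD] G by (simp add: inner_commute)
  have tan: "\<exists>a b. tproj M p w = a *\<^sub>R e1 + b *\<^sub>R e2" for w
    using tproj_in[OF M p, of w] unfolding T by blast
  obtain a b where t1: "tproj M p (diff M E1 p u) = a *\<^sub>R e1 + b *\<^sub>R e2" using tan by blast
  obtain c d where t2: "tproj M p (diff M E2 p u) = c *\<^sub>R e1 + d *\<^sub>R e2" using tan by blast
  have dE: "diff M E1 p u = a *\<^sub>R e1 + b *\<^sub>R e2 + ?B u e1" "diff M E2 p u = c *\<^sub>R e1 + d *\<^sub>R e2 + ?B u e2"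
    using second_fundamental_form_tproj[OF M p u eT(1), folded E1_def]
      second_fundamental_form_tproj[OF M p u eT(2), folded E2_def] t1 t2 by simp_all
  let ?R = "wedge (?B u e1) e2 + wedge e1 (?B u e2)"
  have ww: "wedge e2 e2 = 0" "wedge e1 e1 = 0" by (simp_all add: wedge_def vec_eq_iff)
  have "diff M W p u = (a + d) *\<^sub>R wedge e1 e2 + ?R"
    unfolding WD(2) dE
    by (simp add: linear_add[OF linear_wedge(1)] linear_add[OF linear_wedge(2)]
        linear_scale[OF linear_wedge(1)] linear_scale[OF linear_wedge(2)] ww algebra_simps)
  with 1 have dG: "diff M ?G p u = (a + d - diff M s p u) *\<^sub>R wedge e1 e2 + ?R"
    by (simp add: algebra_simps)
  have B0: "?B u e1 \<bullet> e1 = 0" "?B u e1 \<bullet> e2 = 0" "?B u e2 \<bullet> e1 = 0" "?B u e2 \<bullet> e2 = 0"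
    using second_fundamental_form_normal[OF M p u] eT by blast+
  have "wedge e1 e2 \<bullet> ?R = 0"
    by (simp add: inner_add_right inner_wedge ee inner_commute[of _ "?B u _"] B0)
  then have "(a + d - diff M s p u) * 2 = 0"
    using GdG unfolding dG inner_add_right inner_scaleR_right by (simp add: inner_wedge ee)
  then show ?thesis using dG by simp
qed

lemma pullback_gauss_map:
  fixes M :: "(real^'n) set"
  assumes M: "surface M" and Or: "orientation M Or" and p: "p \<in> M"
    and u: "u \<in> tangent_space M p" and v: "v \<in> tangent_space M p"
    and e: "norm e1 = 1" "norm e2 = 1" "orthogonal e1 e2"
    and T: "tangent_space M p = {a *\<^sub>R e1 + b *\<^sub>R e2 | a b. True}"
    and G: "gauss_map Or p = wedge e1 e2"
  shows "pullback M (gauss_map Or) grassmann_metric p u v =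
    second_fundamental_form M p u e1 \<bullet> second_fundamental_form M p v e1 +
    second_fundamental_form M p u e2 \<bullet> second_fundamental_form M p v e2"
proof -
  have "e1 = 1 *\<^sub>R e1 + 0 *\<^sub>R e2" "e2 = 0 *\<^sub>R e1 + 1 *\<^sub>R e2" by simp_all
  then have eT: "e1 \<in> tangent_space M p" "e2 \<in> tangent_space M p" unfolding T by blast+
  note n = second_fundamental_form_normal[OF M p]
  show ?thesis
    unfolding pullback_def diff_gauss_map[OF M Or p u e T G] diff_gauss_map[OF M Or p v e T G] G
    by (rule grassmann_metric_eq[OF e]) (intro n u v eT)+
qed

section \<open>Conformality in dimension two\<close>

text \<open>The conditions below on the stress-energy tensor, the Gauss map and the mean curvature all say that
  a symmetric form is a multiple of the metric; in a frame this is a condition on three numbers.\<close>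

lemma bilinear_form_conformal_iff:
  fixes b :: "'a::euclidean_space \<Rightarrow> 'a \<Rightarrow> real"
  assumes e: "norm e1 = 1" "norm e2 = 1" "orthogonal e1 e2"
    and T: "T = {a *\<^sub>R e1 + b *\<^sub>R e2 | a b. True}"
    and b: "bilinear_on T b" and sym: "b e2 e1 = b e1 e2"
  shows "(\<forall>u\<in>T. \<forall>v\<in>T. b u v = l * (u \<bullet> v)) \<longleftrightarrow> b e1 e1 = l \<and> b e1 e2 = 0 \<and> b e2 e2 = l"
proof -
  have ee: "e1 \<bullet> e1 = 1" "e2 \<bullet> e2 = 1" "e1 \<bullet> e2 = 0" "e2 \<bullet> e1 = 0"
    using e by (simp_all add: norm_eq_1 orthogonal_def inner_commute)
  have "e1 = 1 *\<^sub>R e1 + 0 *\<^sub>R e2" "e2 = 0 *\<^sub>R e1 + 1 *\<^sub>R e2" by simp_all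
  then have eT: "e1 \<in> T" "e2 \<in> T" unfolding T by blast+
  have inT: "x *\<^sub>R e1 + y *\<^sub>R e2 \<in> T" for x y unfolding T by blast
  have sT: "x *\<^sub>R e1 \<in> T" "x *\<^sub>R e2 \<in> T" for x using inT[of x 0] inT[of 0 x] by simp_all
  have add: "b (u + v) w = b u w + b v w" "b w (u + v) = b w u + b w v"
    if "u \<in> T" "v \<in> T" "w \<in> T" for u v w using b that unfolding bilinear_on_def by blast+
  have scale: "b (c *\<^sub>R u) v = c * b u v" "b u (c *\<^sub>R v) = c * b u v"
    if "u \<in> T" "v \<in> T" for c u v using b that unfolding bilinear_on_def by simp_all
  have expand: "b (x *\<^sub>R e1 + y *\<^sub>R e2) (z *\<^sub>R e1 + w *\<^sub>R e2) =
     x * z * b e1 e1 + (x * w + y * z) * b e1 e2 + y * w * b e2 e2" for x y z w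
    by (simp add: add scale sT inT eT sym algebra_simps)
  show ?thesis
  proof
    assume "\<forall>u\<in>T. \<forall>v\<in>T. b u v = l * (u \<bullet> v)"
    then show "b e1 e1 = l \<and> b e1 e2 = 0 \<and> b e2 e2 = l" using eT ee by simp
  next
    assume *: "b e1 e1 = l \<and> b e1 e2 = 0 \<and> b e2 e2 = l"
    have "b (x *\<^sub>R e1 + y *\<^sub>R e2) (z *\<^sub>R e1 + w *\<^sub>R e2) =
        l * ((x *\<^sub>R e1 + y *\<^sub>R e2) \<bullet> (z *\<^sub>R e1 + w *\<^sub>R e2))" for x y z w
      unfolding expand using * by (simp add: inner_add_left inner_add_right ee algebra_simps)
    then show "\<forall>u\<in>T. \<forall>v\<in>T. b u v = l * (u \<bullet> v)" unfolding T by blast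
  qed
qed

lemma bilinear_on_cong:
  assumes "subspace V" "\<And>u v. u \<in> V \<Longrightarrow> v \<in> V \<Longrightarrow> b u v = b' u v" "bilinear_on V b"
  shows "bilinear_on V b'"
  using assms unfolding bilinear_on_def
  by (simp add: subspace_add[OF assms(1)] subspace_mul[OF assms(1)] assms(2)[symmetric])

text \<open>In an orthonormal frame write \<open>a\<close>, \<open>b\<close>, \<open>c\<close> for the components \<open>B\<^sub>1\<^sub>1\<close>, \<open>B\<^sub>1\<^sub>2\<close>, \<open>B\<^sub>2\<^sub>2\<close> of \<open>B\<close>.  The pullback
  \<open>P\<close> of the canonical metric satisfies \<open>P\<^sub>1\<^sub>2 = (a + c) \<bullet> b\<close> and \<open>P\<^sub>1\<^sub>1 - P\<^sub>2\<^sub>2 = (a + c) \<bullet> (a - c)\<close>, where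
  \<open>a + c = 2 H\<close>.  So \<open>P\<close> is a multiple of the metric if and only if the form \<open>H \<bullet> B\<close> is one, and the
  factor of the latter is then half of its trace, namely \<open>|H|\<^sup>2\<close>.  A multiple of the metric in dimension
  two is half of its trace times the metric, which is the vanishing of the stress-energy tensor.\<close>

lemma pointwise_equivalences:
  fixes M :: "(real^'n) set"
  assumes M: "surface M" and Or: "orientation M Or" and p: "p \<in> M"
  defines "T \<equiv> tangent_space M p" and "P \<equiv> pullback M (gauss_map Or) grassmann_metric p"
    and "H \<equiv> mean_curvature M p" and "B \<equiv> second_fundamental_form M p"
  shows "(\<forall>u\<in>T. \<forall>v\<in>T. stress_energy M (gauss_map Or) grassmann_metric p u v = 0) \<longleftrightarrow>
      (\<forall>u\<in>T. \<forall>v\<in>T. H \<bullet> B u v = (norm H)\<^sup>2 * (u \<bullet> v))" (is "?stress \<longleftrightarrow> ?umb")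
    and "(\<exists>l\<ge>0. \<forall>u\<in>T. \<forall>v\<in>T. P u v = l * (u \<bullet> v)) \<longleftrightarrow>
      (\<forall>u\<in>T. \<forall>v\<in>T. H \<bullet> B u v = (norm H)\<^sup>2 * (u \<bullet> v))" (is "?conf \<longleftrightarrow> _")
proof -
  obtain e1 e2 where e: "norm e1 = 1" "norm e2 = 1" "orthogonal e1 e2"
    and T: "T = {a *\<^sub>R e1 + b *\<^sub>R e2 | a b. True}" and G: "gauss_map Or p = wedge e1 e2"
    using gauss_map_differentiable(2)[OF Or p] unfolding T_def by (elim exE conjE)
  have sub: "subspace T" unfolding T_def by (rule subspace_tangent_space[OF M p])
  have "e1 = 1 *\<^sub>R e1 + 0 *\<^sub>R e2" "e2 = 0 *\<^sub>R e1 + 1 *\<^sub>R e2" by simp_all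
  then have eT: "e1 \<in> T" "e2 \<in> T" unfolding T by blast+
  have "e1 \<noteq> e2" using e by (auto simp: orthogonal_def norm_eq_1)
  have onb: "orthonormal_basis T {e1, e2}"
    unfolding orthonormal_basis_def T span_insert span_singleton
    using e by (auto simp: pairwise_def orthogonal_commute algebra_simps)
  have Bbil: "bilinear_on T B" unfolding T_def B_def by (rule second_fundamental_form_bilinear[OF M p])
  have Bsym: "B u v = B v u" if "u \<in> T" "v \<in> T" for u v
    using second_fundamental_form_symmetric[OF M p] that unfolding T_def B_def by blast
  define a b c where "a = B e1 e1" and "b = B e1 e2" and "c = B e2 e2"
  have b': "B e2 e1 = b" unfolding b_def by (rule Bsym[OF eT(2,1)])
  have Pval: "P u v = B u e1 \<bullet> B v e1 + B u e2 \<bullet> B v e2" if "u \<in> T" "v \<in> T" for u v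
    unfolding P_def B_def using pullback_gauss_map[OF M Or p _ _ e _ G] that T unfolding T_def by blast
  have Pbil: "bilinear_on T P"
  proof (rule bilinear_on_cong[OF sub])
    show "bilinear_on T (\<lambda>u v. B u e1 \<bullet> B v e1 + B u e2 \<bullet> B v e2)"
      using Bbil eT unfolding bilinear_on_def by (simp add: inner_add_left inner_add_right algebra_simps)
  qed (simp add: Pval)
  have Pij: "P e1 e1 = a \<bullet> a + b \<bullet> b" "P e1 e2 = b \<bullet> (a + c)" "P e2 e1 = P e1 e2" "P e2 e2 = b \<bullet> b + c \<bullet> c"
    using eT by (simp_all add: Pval b' a_def[symmetric] b_def[symmetric] c_def[symmetric]
        inner_add_right inner_commute)
  have H: "2 *\<^sub>R H = a + c"
    unfolding H_def mean_curvature_def a_def c_def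
    using trace_on_pair[OF onb \<open>e1 \<noteq> e2\<close> Bbil] unfolding T_def B_def by simp
  have "bilinear_on T (\<lambda>u v. H \<bullet> B u v)"
    using bilinear_on_inner_const[OF Bbil, of H] by (simp add: inner_commute)
  from bilinear_form_conformal_iff[OF e T this]
  have "?umb \<longleftrightarrow> H \<bullet> a = (norm H)\<^sup>2 \<and> H \<bullet> b = 0 \<and> H \<bullet> c = (norm H)\<^sup>2"
    by (simp add: b' a_def b_def c_def)
  also have "\<dots> \<longleftrightarrow> (2 *\<^sub>R H) \<bullet> (a - c) = 0 \<and> b \<bullet> (2 *\<^sub>R H) = 0"
  proof -
    have "2 * (norm H)\<^sup>2 = H \<bullet> (2 *\<^sub>R H)" by (simp add: power2_norm_eq_inner)
    then have "2 * (norm H)\<^sup>2 = H \<bullet> a + H \<bullet> c" unfolding H by (simp add: inner_add_right)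
    then show ?thesis by (auto simp: inner_diff_right inner_commute)
  qed
  also have "\<dots> \<longleftrightarrow> P e1 e1 = P e2 e2 \<and> P e1 e2 = 0"
  proof -
    have "(a + c) \<bullet> (a - c) = a \<bullet> a - c \<bullet> c"
      by (simp add: inner_diff_right inner_add_left inner_commute[of c a])
    then show ?thesis unfolding H Pij by auto
  qed
  finally have umb: "?umb \<longleftrightarrow> P e1 e1 = P e2 e2 \<and> P e1 e2 = 0" .
  have conf: "(\<forall>u\<in>T. \<forall>v\<in>T. P u v = l * (u \<bullet> v)) \<longleftrightarrow> P e1 e1 = l \<and> P e1 e2 = 0 \<and> P e2 e2 = l" for l
    by (rule bilinear_form_conformal_iff[OF e T Pbil Pij(3)])
  have energy: "energy_density M (gauss_map Or) grassmann_metric p = (P e1 e1 + P e2 e2) / 2"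
    unfolding energy_density_def
    using trace_on_pair[OF onb \<open>e1 \<noteq> e2\<close> Pbil] unfolding T_def P_def by simp
  have "?stress \<longleftrightarrow> (\<forall>u\<in>T. \<forall>v\<in>T. P u v = (P e1 e1 + P e2 e2) / 2 * (u \<bullet> v))"
    unfolding stress_energy_def P_def[symmetric] energy by (intro ball_cong refl) auto
  also have "\<dots> \<longleftrightarrow> ?umb" unfolding conf umb by (auto simp: field_simps)
  finally show "?stress \<longleftrightarrow> ?umb" .
  have "P e1 e1 \<ge> 0" unfolding Pij by simp
  then show "?conf \<longleftrightarrow> ?umb" unfolding conf umb by auto
qed

theorem proposition10:
  fixes M :: "(real^'n) set" and Or :: "real^'n \<Rightarrow> ((real^'n) \<times> (real^'n)) set"
  assumes "surface M" and "orientation M Or"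
  shows "((\<forall>p\<in>M. \<forall>u\<in>tangent_space M p. \<forall>v\<in>tangent_space M p.
             stress_energy M (gauss_map Or) grassmann_metric p u v = 0)
          \<longleftrightarrow> weakly_conformal M (gauss_map Or) grassmann_metric)
       \<and> (weakly_conformal M (gauss_map Or) grassmann_metric \<longleftrightarrow> pseudo_umbilical M)
       \<and> (pseudo_umbilical M \<longleftrightarrow>
            (\<forall>p\<in>M. \<forall>u\<in>tangent_space M p. \<forall>v\<in>tangent_space M p.
               biharmonic_stress_energy M id p u v = (norm (tension M id p))\<^sup>2 / 2 * (u \<bullet> v)))"
proof -
  note M = assms(1) and Or = assms(2)
  have ac: "(\<forall>p\<in>M. \<forall>u\<in>tangent_space M p. \<forall>v\<in>tangent_space M p.
      stress_energy M (gauss_map Or) grassmann_metric p u v = 0) \<longleftrightarrow> pseudo_umbilical M"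
    unfolding pseudo_umbilical_def by (rule ball_cong[OF refl pointwise_equivalences(1)[OF M Or]])
  have bc: "weakly_conformal M (gauss_map Or) grassmann_metric \<longleftrightarrow> pseudo_umbilical M"
    unfolding weakly_conformal_def pseudo_umbilical_def
      bchoice_iff[of M "\<lambda>p l. l \<ge> 0 \<and> (\<forall>u\<in>tangent_space M p. \<forall>v\<in>tangent_space M p.
        pullback M (gauss_map Or) grassmann_metric p u v = l * (u \<bullet> v))", symmetric]
    by (rule ball_cong[OF refl pointwise_equivalences(2)[OF M Or]])
  \<comment> \<open>The two sides of (d) differ by \<open>4 (H \<bullet> B - |H|\<^sup>2 g)\<close>.\<close>
  have cd: "pseudo_umbilical M \<longleftrightarrow>
      (\<forall>p\<in>M. \<forall>u\<in>tangent_space M p. \<forall>v\<in>tangent_space M p.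
         biharmonic_stress_energy M id p u v = (norm (tension M id p))\<^sup>2 / 2 * (u \<bullet> v))"
    unfolding pseudo_umbilical_def
  proof (intro ball_cong refl)
    fix p u v assume p: "p \<in> M" and uv: "u \<in> tangent_space M p" "v \<in> tangent_space M p"
    have "(norm (tension M id p))\<^sup>2 / 2 = 2 * (norm (mean_curvature M p))\<^sup>2"
      unfolding tension_id[OF M p] by (simp add: power_mult_distrib)
    then show "mean_curvature M p \<bullet> second_fundamental_form M p u v =
          (norm (mean_curvature M p))\<^sup>2 * (u \<bullet> v) \<longleftrightarrow>
        biharmonic_stress_energy M id p u v = (norm (tension M id p))\<^sup>2 / 2 * (u \<bullet> v)"
      unfolding biharmonic_stress_energy_id[OF M p uv] by (auto simp: algebra_simps)
  qed
  show ?thesis using ac bc cd by blast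
qed

end
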